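(* Let $\mathcal{C}$ be a semi-abelian action accessible category, let $h\colon H\rightarrowtail G$ be a characteristic subobject in $\mathcal{C}$, and let $q\colon G\to G/H$ be the cokernel of $h$. For every object $B$ and every action $\xi\colon B\flat G\to G$, with restricted action $\overline{\xi}$ of $B$ on $H$ and induced action $\widetilde{\xi}$ of $B$ on $G/H$: (i) $h$ induces a morphism between canonical faithful split extensions: there are morphisms $T_1(B,G,\xi)\to T_1(B,G/H,\widetilde{\xi})$ and $T_0(B,G,\xi)\to T_0(B,G/H,\widetilde{\xi})$ which, together with $q\colon G\to G/H$ on kernels, form a morphism (commuting with kernel inclusions, projections and sections) from the split extension $G\to T_1(B,G,\xi)\rightleftarrows T_0(B,G,\xi)$ to the split extension $G/H\to T_1(B,G/H,\widetilde{\xi})\rightleftarrows T_0(B,G/H,\widetilde{\xi})$; (ii) $h$ induces a morphism $T_0(B,G,\xi)\to T_0(B,H,\overline{\xi})$.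
   Context: For an object $B$ of a pointed category $\mathcal{C}$ with finite limits and finite coproducts, let $\mathrm{Pt}_B(\mathcal{C})$ be the category of points over $B$: objects are split epimorphisms $(A,p,s)$ with $p\colon A\to B$, $s\colon B\to A$, $ps=1_B$; morphisms $(A,p,s)\to(A',p',s')$ are arrows $f\colon A\to A'$ with $p'f=p$, $fs=s'$. The functor $\mathrm{Ker}_B\colon \mathrm{Pt}_B(\mathcal{C})\to\mathcal{C}$, $(A,p,s)\mapsto \mathrm{Ker}(p)$, is right adjoint to $B+(-)$, which sends $X$ to the point $(B+X,[1,0],\iota_B)$. The induced monad on $\mathcal{C}$ is denoted $B\flat(-)$, so that $B\flat X$ is the kernel of $[1,0]\colon B+X\to B$. An (internal) action of $B$ on $X$ is an algebra $\xi\colon B\flat X\to X$ for this monad. A point $(A,p,s)$ over $B$ with kernel $k\colon X\to A$ determines the action $\xi$ of $B$ on $X$ with $k\xi=[s,k]\ker[1,0]$; in a semi-abelian category this gives an equivalence between points over $B$ and actions of $B$, and the point corresponding to $\xi\colon B\flat X\to X$ is written $X\rtimes_\xi B\rightleftarrows B$. A subobject $h\colon H\rightarrowtail G$ is called characteristic in $G$ if for every object $B$ and every action $\xi\colon B\flat G\to G$ there exists a (unique) action $\overline{\xi}\colon B\flat H\to H$ with $h\,\overline{\xi}=\xi\,(1_B\flat h)$. In a semi-abelian category, a characteristic subobject $H$ of $G$ is normal, and every action $\xi$ of $B$ on $G$ induces a unique action $\widetilde{\xi}$ of $B$ on $G/H$ with $\widetilde{\xi}\,(1_B\flat q)=q\,\xi$,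 where $q\colon G\to G/H$ is the quotient. A split extension with kernel $K$ is a diagram $K\xrightarrow{k}A\rightleftarrows B$ with $p\colon A\to B$, $s\colon B\to A$, $ps=1_B$ and $k=\ker p$. The category $\mathsf{SplExt}(K)$ has these as objects; a morphism from $(B,A,p,s,k)$ to $(D,C,r,t,l)$ is a pair $(g\colon B\to D,\ f\colon A\to C)$ with $l=fk$, $rf=gp$, $fs=tg$ (so it is the identity on $K$). An object of $\mathsf{SplExt}(K)$ is faithful if every object of $\mathsf{SplExt}(K)$ admits at most one morphism into it. The semi-abelian category $\mathcal{C}$ is action accessible if for every $K$, every object of $\mathsf{SplExt}(K)$ admits a morphism into a faithful one. Canonical faithful split extension: given an action $\xi$ of $B$ on $X$, with corresponding split extension $X\to X\rtimes_\xi B\rightleftarrows B$, choose a morphism $(g,f)$ in $\mathsf{SplExt}(X)$ to a faithful split extension $X\to C\rightleftarrows D$, and take the (regular epi, mono) factorisations of $f$ and $g$. The resulting intermediate split extension $X\to T_1(B,X,\xi)\rightleftarrows T_0(B,X,\xi)$ is faithful and independent of the choice of the faithful split extension; it comes with regular epimorphisms $X\rtimes_\xi B\to T_1(B,X,\xi)$ and $B\to T_0(B,X,\xi)$. *)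

theory Defs
  imports Main
begin

section \<open>Categories\<close>

record ('o, 'm) cat =
  Obj :: "'o set"
  Arr :: "'m set"
  Dom :: "'m \<Rightarrow> 'o"
  Cod :: "'m \<Rightarrow> 'o"
  Id :: "'o \<Rightarrow> 'm"
  Comp :: "'m \<Rightarrow> 'm \<Rightarrow> 'm"  (infixr "\<cdot>\<index>" 70)

definition hom :: "('o, 'm) cat \<Rightarrow> 'o \<Rightarrow> 'o \<Rightarrow> 'm set" where
  "hom C A B = {f \<in> Arr C. Dom C f = A \<and> Cod C f = B}"

locale category =
  fixes C :: "('o, 'm) cat" (structure)
  assumes dom_obj: "f \<in> Arr C \<Longrightarrow> Dom C f \<in> Obj C"
    and cod_obj: "f \<in> Arr C \<Longrightarrow> Cod C f \<in> Obj C"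
    and id_hom: "A \<in> Obj C \<Longrightarrow> Id C A \<in> hom C A A"
    and comp_hom: "f \<in> hom C A B \<Longrightarrow> g \<in> hom C B D \<Longrightarrow> g \<cdot> f \<in> hom C A D"
    and id_left: "f \<in> hom C A B \<Longrightarrow> Id C B \<cdot> f = f"
    and id_right: "f \<in> hom C A B \<Longrightarrow> f \<cdot> Id C A = f"
    and assoc: "f \<in> hom C A B \<Longrightarrow> g \<in> hom C B D \<Longrightarrow> k \<in> hom C D E
      \<Longrightarrow> (k \<cdot> g) \<cdot> f = k \<cdot> (g \<cdot> f)"

definition monic :: "('o, 'm) cat \<Rightarrow> 'm \<Rightarrow> bool" where
  "monic C m \<longleftrightarrow> m \<in> Arr C \<and>
     (\<forall>Z. \<forall>f \<in> hom C Z (Dom C m). \<forall>g \<in> hom C Z (Dom C m).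
        m \<cdot>\<^bsub>C\<^esub> f = m \<cdot>\<^bsub>C\<^esub> g \<longrightarrow> f = g)"

definition isomorphism :: "('o, 'm) cat \<Rightarrow> 'm \<Rightarrow> bool" where
  "isomorphism C f \<longleftrightarrow> f \<in> Arr C \<and>
     (\<exists>g \<in> hom C (Cod C f) (Dom C f).
        g \<cdot>\<^bsub>C\<^esub> f = Id C (Dom C f) \<and> f \<cdot>\<^bsub>C\<^esub> g = Id C (Cod C f))"

definition coequalizer :: "('o, 'm) cat \<Rightarrow> 'm \<Rightarrow> 'm \<Rightarrow> 'm \<Rightarrow> bool" where
  "coequalizer C f g q \<longleftrightarrow>
     (\<exists>R A Q. f \<in> hom C R A \<and> g \<in> hom C R A \<and> q \<in> hom C A Q \<and>
        q \<cdot>\<^bsub>C\<^esub> f = q \<cdot>\<^bsub>C\<^esub> g \<and>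
        (\<forall>Z. \<forall>z \<in> hom C A Z. z \<cdot>\<^bsub>C\<^esub> f = z \<cdot>\<^bsub>C\<^esub> g \<longrightarrow>
           (\<exists>!u. u \<in> hom C Q Z \<and> u \<cdot>\<^bsub>C\<^esub> q = z)))"

definition regular_epi :: "('o, 'm) cat \<Rightarrow> 'm \<Rightarrow> bool" where
  "regular_epi C q \<longleftrightarrow> (\<exists>f g. coequalizer C f g q)"

text \<open>The square \<open>f \<cdot> a = g \<cdot> b\<close> is a pullback, with projections \<open>a\<close> and \<open>b\<close>.\<close>

definition pullback :: "('o, 'm) cat \<Rightarrow> 'm \<Rightarrow> 'm \<Rightarrow> 'm \<Rightarrow> 'm \<Rightarrow> bool" where
  "pullback C f g a b \<longleftrightarrow>
     (\<exists>P A B D. f \<in> hom C A D \<and> g \<in> hom C B D \<and> a \<in> hom C P A \<and> b \<in> hom C P B \<and>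
        f \<cdot>\<^bsub>C\<^esub> a = g \<cdot>\<^bsub>C\<^esub> b \<and>
        (\<forall>Z. \<forall>x \<in> hom C Z A. \<forall>y \<in> hom C Z B. f \<cdot>\<^bsub>C\<^esub> x = g \<cdot>\<^bsub>C\<^esub> y \<longrightarrow>
           (\<exists>!u. u \<in> hom C Z P \<and> a \<cdot>\<^bsub>C\<^esub> u = x \<and> b \<cdot>\<^bsub>C\<^esub> u = y)))"

definition coproduct :: "('o, 'm) cat \<Rightarrow> 'o \<Rightarrow> 'o \<Rightarrow> 'm \<Rightarrow> 'm \<Rightarrow> bool" where
  "coproduct C A B i j \<longleftrightarrow>
     (\<exists>S. i \<in> hom C A S \<and> j \<in> hom C B S \<and>
        (\<forall>Z. \<forall>x \<in> hom C A Z. \<forall>y \<in> hom C B Z.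
           (\<exists>!u. u \<in> hom C S Z \<and> u \<cdot>\<^bsub>C\<^esub> i = x \<and> u \<cdot>\<^bsub>C\<^esub> j = y)))"

definition zero_object :: "('o, 'm) cat \<Rightarrow> 'o \<Rightarrow> bool" where
  "zero_object C Z \<longleftrightarrow> Z \<in> Obj C \<and>
     (\<forall>A \<in> Obj C. (\<exists>!f. f \<in> hom C Z A) \<and> (\<exists>!f. f \<in> hom C A Z))"

definition zero_arr :: "('o, 'm) cat \<Rightarrow> 'o \<Rightarrow> 'o \<Rightarrow> 'm" where
  "zero_arr C A B =
     (THE f. \<exists>Z u v. zero_object C Z \<and> u \<in> hom C A Z \<and> v \<in> hom C Z B \<and> f = v \<cdot>\<^bsub>C\<^esub> u)"

definition kernel :: "('o, 'm) cat \<Rightarrow> 'm \<Rightarrow> 'm \<Rightarrow> bool" where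
  "kernel C f k \<longleftrightarrow>
     (\<exists>K A B. f \<in> hom C A B \<and> k \<in> hom C K A \<and> f \<cdot>\<^bsub>C\<^esub> k = zero_arr C K B \<and>
        (\<forall>Z. \<forall>z \<in> hom C Z A. f \<cdot>\<^bsub>C\<^esub> z = zero_arr C Z B \<longrightarrow>
           (\<exists>!u. u \<in> hom C Z K \<and> k \<cdot>\<^bsub>C\<^esub> u = z)))"

definition cokernel :: "('o, 'm) cat \<Rightarrow> 'm \<Rightarrow> 'm \<Rightarrow> bool" where
  "cokernel C f q \<longleftrightarrow>
     (\<exists>A B Q. f \<in> hom C A B \<and> q \<in> hom C B Q \<and> q \<cdot>\<^bsub>C\<^esub> f = zero_arr C A Q \<and>
        (\<forall>Z. \<forall>z \<in> hom C B Z. z \<cdot>\<^bsub>C\<^esub> f = zero_arr C A Z \<longrightarrow>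
           (\<exists>!u. u \<in> hom C Q Z \<and> u \<cdot>\<^bsub>C\<^esub> q = z)))"


section \<open>Semi-abelian categories\<close>

text \<open>An internal equivalence relation on \<open>A\<close>: a jointly monic pair \<open>r1, r2\<close> that is
  reflexive, symmetric and transitive.\<close>

definition equivalence_relation :: "('o, 'm) cat \<Rightarrow> 'o \<Rightarrow> 'm \<Rightarrow> 'm \<Rightarrow> bool" where
  "equivalence_relation C A r1 r2 \<longleftrightarrow>
     (\<exists>R. r1 \<in> hom C R A \<and> r2 \<in> hom C R A \<and>
        (\<forall>Z. \<forall>x \<in> hom C Z R. \<forall>y \<in> hom C Z R.
           r1 \<cdot>\<^bsub>C\<^esub> x = r1 \<cdot>\<^bsub>C\<^esub> y \<and> r2 \<cdot>\<^bsub>C\<^esub> x = r2 \<cdot>\<^bsub>C\<^esub> y \<longrightarrow> x = y) \<and>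
        (\<exists>d \<in> hom C A R. r1 \<cdot>\<^bsub>C\<^esub> d = Id C A \<and> r2 \<cdot>\<^bsub>C\<^esub> d = Id C A) \<and>
        (\<exists>\<sigma> \<in> hom C R R. r1 \<cdot>\<^bsub>C\<^esub> \<sigma> = r2 \<and> r2 \<cdot>\<^bsub>C\<^esub> \<sigma> = r1) \<and>
        (\<forall>a b. pullback C r2 r1 a b \<longrightarrow>
           (\<exists>t \<in> hom C (Dom C a) R.
              r1 \<cdot>\<^bsub>C\<^esub> t = r1 \<cdot>\<^bsub>C\<^esub> a \<and> r2 \<cdot>\<^bsub>C\<^esub> t = r2 \<cdot>\<^bsub>C\<^esub> b)))"

definition point :: "('o, 'm) cat \<Rightarrow> 'o \<Rightarrow> 'o \<Rightarrow> 'm \<Rightarrow> 'm \<Rightarrow> bool" where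
  "point C B A p s \<longleftrightarrow>
     p \<in> hom C A B \<and> s \<in> hom C B A \<and> p \<cdot>\<^bsub>C\<^esub> s = Id C B"

definition pt_hom :: "('o, 'm) cat \<Rightarrow> 'o \<times> 'm \<times> 'm \<Rightarrow> 'o \<times> 'm \<times> 'm \<Rightarrow> 'm set" where
  "pt_hom C = (\<lambda>(A, p, s) (A', p', s').
     {f \<in> hom C A A'. p' \<cdot>\<^bsub>C\<^esub> f = p \<and> f \<cdot>\<^bsub>C\<^esub> s = s'})"

locale pointed_category = category +
  assumes ex_zero: "\<exists>Z. zero_object C Z"

text \<open>Finite limits are given by the zero object, which is terminal, and pullbacks; finite
  coproducts by the zero object, which is initial, and binary coproducts.\<close>

locale regular_category = pointed_category +
  assumes ex_pullback: "f \<in> hom C A D \<Longrightarrow> g \<in> hom C B D \<Longrightarrow> \<exists>a b. pullback C f g a b"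
    and ex_coeq_kernel_pair: "pullback C f f a b \<Longrightarrow> \<exists>q. coequalizer C a b q"
    and regular_epi_stable: "pullback C f g a b \<Longrightarrow> regular_epi C f \<Longrightarrow> regular_epi C b"

locale exact_category = regular_category +
  assumes effective: "equivalence_relation C A r1 r2 \<Longrightarrow> \<exists>f. pullback C f f r1 r2"

text \<open>Protomodularity: for each \<open>v : E \<rightarrow> B\<close>, the change-of-base functor from points over
  \<open>B\<close> to points over \<open>E\<close> reflects isomorphisms. Here \<open>u\<close> is the image of \<open>f\<close> under this
  functor, computed with respect to arbitrary pullbacks \<open>(a, b)\<close> and \<open>(a', b')\<close>.\<close>

definition protomodular :: "('o, 'm) cat \<Rightarrow> bool" where
  "protomodular C \<longleftrightarrow>
     (\<forall>B A p s A' p' s' f v a b a' b' u.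
        point C B A p s \<and> point C B A' p' s' \<and> f \<in> pt_hom C (A, p, s) (A', p', s') \<and>
        pullback C p v a b \<and> pullback C p' v a' b' \<and>
        u \<in> hom C (Dom C a) (Dom C a') \<and>
        a' \<cdot>\<^bsub>C\<^esub> u = f \<cdot>\<^bsub>C\<^esub> a \<and> b' \<cdot>\<^bsub>C\<^esub> u = b \<and>
        isomorphism C u \<longrightarrow> isomorphism C f)"

locale semi_abelian_category = exact_category +
  assumes ex_coproduct: "A \<in> Obj C \<Longrightarrow> B \<in> Obj C \<Longrightarrow> \<exists>i j. coproduct C A B i j"
    and protomodular: "protomodular C"


section \<open>Internal actions\<close>

text \<open>A coproduct \<open>B + X\<close> and a kernel of \<open>[1,0] : B + X \<rightarrow> B\<close> are chosen for all \<open>B\<close> and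
  \<open>X\<close>, which fixes the functor \<open>B\<flat>(-)\<close>.\<close>

definition inj1 :: "('o, 'm) cat \<Rightarrow> 'o \<Rightarrow> 'o \<Rightarrow> 'm" where
  "inj1 C A B = fst (SOME (i, j). coproduct C A B i j)"

definition inj2 :: "('o, 'm) cat \<Rightarrow> 'o \<Rightarrow> 'o \<Rightarrow> 'm" where
  "inj2 C A B = snd (SOME (i, j). coproduct C A B i j)"

definition sum_obj :: "('o, 'm) cat \<Rightarrow> 'o \<Rightarrow> 'o \<Rightarrow> 'o" where
  "sum_obj C A B = Cod C (inj1 C A B)"

definition copair :: "('o, 'm) cat \<Rightarrow> 'm \<Rightarrow> 'm \<Rightarrow> 'm" where
  "copair C f g = (THE u. u \<in> hom C (sum_obj C (Dom C f) (Dom C g)) (Cod C f) \<and>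
     u \<cdot>\<^bsub>C\<^esub> inj1 C (Dom C f) (Dom C g) = f \<and>
     u \<cdot>\<^bsub>C\<^esub> inj2 C (Dom C f) (Dom C g) = g)"

definition flat_incl :: "('o, 'm) cat \<Rightarrow> 'o \<Rightarrow> 'o \<Rightarrow> 'm" where
  "flat_incl C B X = (SOME k. kernel C (copair C (Id C B) (zero_arr C X B)) k)"

definition flat :: "('o, 'm) cat \<Rightarrow> 'o \<Rightarrow> 'o \<Rightarrow> 'o" where
  "flat C B X = Dom C (flat_incl C B X)"

text \<open>The arrow \<open>1\<^sub>B\<flat>h : B\<flat>X \<rightarrow> B\<flat>Y\<close>, for \<open>h : X \<rightarrow> Y\<close>, is the restriction of \<open>1\<^sub>B + h\<close> to the kernels.\<close>

definition flat_map :: "('o, 'm) cat \<Rightarrow> 'o \<Rightarrow> 'm \<Rightarrow> 'm" where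
  "flat_map C B h = (let X = Dom C h; Y = Cod C h in
     THE u. u \<in> hom C (flat C B X) (flat C B Y) \<and>
       flat_incl C B Y \<cdot>\<^bsub>C\<^esub> u =
         copair C (inj1 C B Y) (inj2 C B Y \<cdot>\<^bsub>C\<^esub> h) \<cdot>\<^bsub>C\<^esub> flat_incl C B X)"

text \<open>The unit of the adjunction at \<open>X\<close> is the factorisation of the second injection
  \<open>X \<rightarrow> B + X\<close> through the kernel. The counit at a point \<open>(A, p, s)\<close> with kernel \<open>k\<close>
  is \<open>[s, k]\<close>; the multiplication at \<open>X\<close> is the restriction to the kernels of the counit at the
  point \<open>(B + X, [1,0], \<iota>\<^sub>B)\<close>.\<close>

definition flat_unit :: "('o, 'm) cat \<Rightarrow> 'o \<Rightarrow> 'o \<Rightarrow> 'm" where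
  "flat_unit C B X = (THE u. u \<in> hom C X (flat C B X) \<and>
     flat_incl C B X \<cdot>\<^bsub>C\<^esub> u = inj2 C B X)"

definition flat_mult :: "('o, 'm) cat \<Rightarrow> 'o \<Rightarrow> 'o \<Rightarrow> 'm" where
  "flat_mult C B X = (THE u. u \<in> hom C (flat C B (flat C B X)) (flat C B X) \<and>
     flat_incl C B X \<cdot>\<^bsub>C\<^esub> u =
       copair C (inj1 C B X) (flat_incl C B X) \<cdot>\<^bsub>C\<^esub> flat_incl C B (flat C B X))"

definition internal_action :: "('o, 'm) cat \<Rightarrow> 'o \<Rightarrow> 'o \<Rightarrow> 'm \<Rightarrow> bool" where
  "internal_action C B X \<xi> \<longleftrightarrow> B \<in> Obj C \<and> X \<in> Obj C \<and> \<xi> \<in> hom C (flat C B X) X \<and>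
     \<xi> \<cdot>\<^bsub>C\<^esub> flat_unit C B X = Id C X \<and>
     \<xi> \<cdot>\<^bsub>C\<^esub> flat_mult C B X = \<xi> \<cdot>\<^bsub>C\<^esub> flat_map C B \<xi>"

text \<open>The restricted action below is unique because \<open>h\<close> is monic.\<close>

definition characteristic :: "('o, 'm) cat \<Rightarrow> 'm \<Rightarrow> bool" where
  "characteristic C h \<longleftrightarrow> monic C h \<and>
     (\<forall>B \<xi>. internal_action C B (Cod C h) \<xi> \<longrightarrow>
        (\<exists>\<xi>'. internal_action C B (Dom C h) \<xi>' \<and>
           h \<cdot>\<^bsub>C\<^esub> \<xi>' = \<xi> \<cdot>\<^bsub>C\<^esub> flat_map C B h))"


section \<open>Split extensions\<close>

text \<open>The objects of a split extension are recovered as domains and codomains of its arrows.\<close>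

record 'm splext =
  proj :: 'm
  sect :: 'm
  incl :: 'm

definition base :: "('o, 'm) cat \<Rightarrow> 'm splext \<Rightarrow> 'o" where
  "base C E = Cod C (proj E)"

definition total :: "('o, 'm) cat \<Rightarrow> 'm splext \<Rightarrow> 'o" where
  "total C E = Dom C (proj E)"

definition SplExt :: "('o, 'm) cat \<Rightarrow> 'o \<Rightarrow> 'm splext set" where
  "SplExt C K = {E. point C (base C E) (total C E) (proj E) (sect E) \<and>
     kernel C (proj E) (incl E) \<and> Dom C (incl E) = K}"

text \<open>Morphisms of split extensions with an arbitrary arrow \<open>x\<close> on kernels; those of
  \<open>SplExt C K\<close> are the ones with \<open>x = 1\<^sub>K\<close>.\<close>

definition splext_mor ::
    "('o, 'm) cat \<Rightarrow> 'm splext \<Rightarrow> 'm splext \<Rightarrow> 'm \<Rightarrow> 'm \<Rightarrow> 'm \<Rightarrow> bool" where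
  "splext_mor C E F x g f \<longleftrightarrow>
     E \<in> SplExt C (Dom C x) \<and> F \<in> SplExt C (Cod C x) \<and> x \<in> Arr C \<and>
     g \<in> hom C (base C E) (base C F) \<and> f \<in> hom C (total C E) (total C F) \<and>
     incl F \<cdot>\<^bsub>C\<^esub> x = f \<cdot>\<^bsub>C\<^esub> incl E \<and>
     proj F \<cdot>\<^bsub>C\<^esub> f = g \<cdot>\<^bsub>C\<^esub> proj E \<and>
     f \<cdot>\<^bsub>C\<^esub> sect E = sect F \<cdot>\<^bsub>C\<^esub> g"

definition SplExt_hom ::
    "('o, 'm) cat \<Rightarrow> 'o \<Rightarrow> 'm splext \<Rightarrow> 'm splext \<Rightarrow> ('m \<times> 'm) set" where
  "SplExt_hom C K E F = {(g, f). splext_mor C E F (Id C K) g f}"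

definition faithful :: "('o, 'm) cat \<Rightarrow> 'o \<Rightarrow> 'm splext \<Rightarrow> bool" where
  "faithful C K F \<longleftrightarrow> F \<in> SplExt C K \<and>
     (\<forall>E \<in> SplExt C K. \<forall>m \<in> SplExt_hom C K E F. \<forall>n \<in> SplExt_hom C K E F. m = n)"

locale action_accessible_category = semi_abelian_category +
  assumes ex_faithful: "K \<in> Obj C \<Longrightarrow> E \<in> SplExt C K \<Longrightarrow>
    \<exists>F. faithful C K F \<and> SplExt_hom C K E F \<noteq> {}"

text \<open>\<open>E\<close> is a split extension \<open>X \<rightarrow> X \<rtimes>\<^sub>\<xi> B \<rightleftarrows> B\<close> corresponding to the action \<open>\<xi>\<close>.\<close>

definition semidirect :: "('o, 'm) cat \<Rightarrow> 'o \<Rightarrow> 'o \<Rightarrow> 'm \<Rightarrow> 'm splext \<Rightarrow> bool" where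
  "semidirect C B X \<xi> E \<longleftrightarrow> E \<in> SplExt C X \<and> base C E = B \<and>
     incl E \<cdot>\<^bsub>C\<^esub> \<xi> = copair C (sect E) (incl E) \<cdot>\<^bsub>C\<^esub> flat_incl C B X"

definition image_factorisation :: "('o, 'm) cat \<Rightarrow> 'm \<Rightarrow> 'm \<Rightarrow> 'm \<Rightarrow> bool" where
  "image_factorisation C f e m \<longleftrightarrow>
     regular_epi C e \<and> monic C m \<and> Cod C e = Dom C m \<and> f = m \<cdot>\<^bsub>C\<^esub> e"

text \<open>\<open>T\<close> is the split extension \<open>X \<rightarrow> T\<^sub>1(B,X,\<xi>) \<rightleftarrows> T\<^sub>0(B,X,\<xi>)\<close>, obtained from some split
  extension \<open>E\<close> corresponding to \<open>\<xi>\<close>, some morphism \<open>(g, f)\<close> into a faithful split extension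
  \<open>F\<close> and some factorisations of \<open>g\<close> and \<open>f\<close>; \<open>e0 : B \<rightarrow> T\<^sub>0(B,X,\<xi>)\<close> is the resulting
  regular epimorphism. The arrows of \<open>T\<close> are those induced by the ones of \<open>E\<close> and \<open>F\<close>.\<close>

definition canonical_faithful ::
    "('o, 'm) cat \<Rightarrow> 'o \<Rightarrow> 'o \<Rightarrow> 'm \<Rightarrow> 'm splext \<Rightarrow> 'm \<Rightarrow> bool" where
  "canonical_faithful C B X \<xi> T e0 \<longleftrightarrow>
     (\<exists>E F g f m0 e1 m1.
        semidirect C B X \<xi> E \<and> faithful C X F \<and> (g, f) \<in> SplExt_hom C X E F \<and>
        image_factorisation C g e0 m0 \<and> image_factorisation C f e1 m1 \<and>
        proj T \<in> hom C (Cod C e1) (Cod C e0) \<and>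
        proj T \<cdot>\<^bsub>C\<^esub> e1 = e0 \<cdot>\<^bsub>C\<^esub> proj E \<and> m0 \<cdot>\<^bsub>C\<^esub> proj T = proj F \<cdot>\<^bsub>C\<^esub> m1 \<and>
        sect T \<in> hom C (Cod C e0) (Cod C e1) \<and>
        sect T \<cdot>\<^bsub>C\<^esub> e0 = e1 \<cdot>\<^bsub>C\<^esub> sect E \<and> m1 \<cdot>\<^bsub>C\<^esub> sect T = sect F \<cdot>\<^bsub>C\<^esub> m0 \<and>
        incl T = e1 \<cdot>\<^bsub>C\<^esub> incl E)"

end

theory Submission
  imports Defs
begin

text \<open>Equivariant arrows on kernels extend to morphisms of semidirect products, so \<open>h\<close> and \<open>q\<close> give
  morphisms of split extensions over \<open>B\<close>. Let \<open>(r1, r2)\<close> be the kernel pair of \<open>B \<rightarrow> T\<^sub>0(B,G,\<xi>)\<close>: the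
  split extension of \<open>G\<close> pulls back along \<open>r1\<close> and along \<open>r2\<close> to the same split extension \<open>D\<close>.
  Restricting \<open>D\<close> to \<open>H\<close>, respectively dividing it by \<open>H\<close>, shows that the split extensions of \<open>H\<close>
  and of \<open>G/H\<close> have the same property. A faithful split extension cannot distinguish two
  morphisms from one source, so \<open>r1\<close> and \<open>r2\<close> are coequalized by \<open>B \<rightarrow> T\<^sub>0(B,H,\<xi>H)\<close> and
  \<open>B \<rightarrow> T\<^sub>0(B,G/H,\<xi>Q)\<close>, which therefore factor through \<open>T\<^sub>0(B,G,\<xi>)\<close>. On total objects, use that
  the section and the kernel of \<open>D\<close> are jointly epic.\<close>

section \<open>Limits, colimits and images\<close>

text \<open>In groups, \<open>T\<^sub>0(B,G,\<xi>)\<close> is the image of \<open>B\<close> in the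
  automorphism group of \<open>G\<close>, and the claim says that elements of \<open>B\<close>
  acting alike on \<open>G\<close> also act alike on a characteristic subgroup and on its quotient.
  Without automorphism objects, acting alike is expressed by two morphisms of split extensions with
  a common source, which is why a kernel pair is used and not a kernel. The obstacle is that
  faithfulness only compares morphisms that are the identity on kernels, whereas \<open>D\<close>
  has kernel \<open>G\<close> and the extensions to be compared have kernel \<open>H\<close> or
  \<open>G/H\<close>. Both legs of \<open>D\<close> must therefore be carried over to one common
  object with the new kernel, without changing the base, so that the resulting equation still
  concerns \<open>r1\<close> and \<open>r2\<close> themselves. For \<open>H\<close> this is an
  intersection of two inverse images. For \<open>G/H\<close> it needs the fact that a regular
  epimorphism on kernels, over a fixed base, gives a coequalizer on total objects. That fact rests
  on protomodularity and also produces the morphisms between semidirect products.\<close>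

context category
begin

lemma hom_iff: "f \<in> hom C A B \<longleftrightarrow> f \<in> Arr C \<and> Dom C f = A \<and> Cod C f = B"
  by (simp add: hom_def)

lemma hom_obj:
  assumes "f \<in> hom C A B"
  shows "A \<in> Obj C" "B \<in> Obj C"
  using assms dom_obj cod_obj by (auto simp: hom_iff)

lemma Id_arr [simp]:
  assumes "A \<in> Obj C"
  shows "Id C A \<in> Arr C" "Dom C (Id C A) = A" "Cod C (Id C A) = A"
  using id_hom[OF assms] by (auto simp: hom_iff)

lemma comp_arr [simp]:
  assumes "f \<in> Arr C" "g \<in> Arr C" "Cod C f = Dom C g"
  shows "g \<cdot> f \<in> Arr C" "Dom C (g \<cdot> f) = Dom C f" "Cod C (g \<cdot> f) = Cod C g"
  using comp_hom[of f "Dom C f" "Cod C f" g "Cod C g"] assms by (auto simp: hom_iff)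

lemma comp_assoc [simp]:
  assumes "f \<in> Arr C" "g \<in> Arr C" "k \<in> Arr C" "Cod C f = Dom C g" "Cod C g = Dom C k"
  shows "(k \<cdot> g) \<cdot> f = k \<cdot> (g \<cdot> f)"
  using assoc[of f "Dom C f" "Cod C f" g "Cod C g" k "Cod C k"] assms by (auto simp: hom_iff)

lemma comp_Id [simp]:
  assumes "f \<in> Arr C"
  shows "Cod C f = B \<Longrightarrow> Id C B \<cdot> f = f" "Dom C f = A \<Longrightarrow> f \<cdot> Id C A = f"
  using id_left[of f "Dom C f" "Cod C f"] id_right[of f "Dom C f" "Cod C f"] assms
  by (auto simp: hom_iff)

text \<open>Composites are normalised to right-nested form, where an equation about
  \<open>k \<cdot> g\<close> no longer matches. This turns such an equation into a rewrite rule that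
  applies when a further arrow follows on the right.\<close>

lemma comp_reassoc:
  assumes "k \<cdot> g = l" "g \<in> Arr C" "k \<in> Arr C" "Cod C g = Dom C k"
    "f \<in> Arr C" "Cod C f = Dom C g"
  shows "k \<cdot> (g \<cdot> f) = l \<cdot> f"
  using comp_assoc[of f g k] assms by simp

lemma monicD:
  assumes "monic C m" "m \<cdot> x = m \<cdot> y" "x \<in> hom C Z (Dom C m)" "y \<in> hom C Z (Dom C m)"
  shows "x = y"
  using assms unfolding monic_def by blast

lemma monicI:
  assumes "m \<in> hom C A B"
    and "\<And>Z x y. x \<in> hom C Z A \<Longrightarrow> y \<in> hom C Z A \<Longrightarrow> m \<cdot> x = m \<cdot> y \<Longrightarrow> x = y"
  shows "monic C m"
  using assms unfolding monic_def by (auto simp: hom_iff)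

section \<open>Pullback squares\<close>

lemma pullback_hom:
  assumes "pullback C f g a b"
  shows "f \<in> hom C (Dom C f) (Cod C f)" "g \<in> hom C (Dom C g) (Cod C f)"
    "a \<in> hom C (Dom C a) (Dom C f)" "b \<in> hom C (Dom C a) (Dom C g)"
    "f \<cdot> a = g \<cdot> b"
  using assms by (auto simp: pullback_def hom_iff)

lemma pullback_univ:
  assumes "pullback C f g a b" "x \<in> hom C Z (Dom C f)" "y \<in> hom C Z (Dom C g)"
    "f \<cdot> x = g \<cdot> y"
  shows "\<exists>!u. u \<in> hom C Z (Dom C a) \<and> a \<cdot> u = x \<and> b \<cdot> u = y"
proof -
  obtain P A B D where "f \<in> hom C A D" "g \<in> hom C B D" "a \<in> hom C P A"
    and univ: "\<forall>Z. \<forall>x \<in> hom C Z A. \<forall>y \<in> hom C Z B. f \<cdot> x = g \<cdot> y \<longrightarrow>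
           (\<exists>!u. u \<in> hom C Z P \<and> a \<cdot> u = x \<and> b \<cdot> u = y)"
    using assms(1) unfolding pullback_def by blast
  then have "A = Dom C f" "B = Dom C g" "P = Dom C a" by (auto simp: hom_iff)
  with univ assms(2-) show ?thesis by blast
qed

lemma pullback_factor:
  assumes "pullback C f g a b" "a \<in> hom C P A" "b \<in> hom C P B"
    "x \<in> hom C Z A" "y \<in> hom C Z B" "f \<cdot> x = g \<cdot> y"
  obtains u where "u \<in> hom C Z P" "a \<cdot> u = x" "b \<cdot> u = y"
proof -
  have "A = Dom C f" "B = Dom C g" "P = Dom C a"
    using pullback_hom[OF assms(1)] assms(2,3) by (auto simp: hom_iff)
  with pullback_univ[OF assms(1), of x Z y] assms(4-) show thesis using that by blast
qed

lemma pullback_eqI: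
  assumes "pullback C f g a b" "a \<in> hom C P A" "u \<in> hom C Z P" "v \<in> hom C Z P"
    "a \<cdot> u = a \<cdot> v" "b \<cdot> u = b \<cdot> v"
  shows "u = v"
proof -
  note h = pullback_hom[OF assms(1)]
  have P: "Dom C a = P" using assms(2) by (simp add: hom_iff)
  have "a \<cdot> u \<in> hom C Z (Dom C f)" "b \<cdot> u \<in> hom C Z (Dom C g)"
    using h assms by (auto simp: hom_iff)
  moreover have "f \<cdot> (a \<cdot> u) = g \<cdot> (b \<cdot> u)"
    using h assms(3) P comp_assoc[of u a f] comp_assoc[of u b g] by (simp add: hom_iff)
  ultimately show ?thesis using pullback_univ[OF assms(1)] assms(3-) P by metis
qed

lemma pullbackI:
  assumes "f \<in> hom C A D" "g \<in> hom C B D" "a \<in> hom C P A" "b \<in> hom C P B" "f \<cdot> a = g \<cdot> b"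
    and "\<And>Z x y. x \<in> hom C Z A \<Longrightarrow> y \<in> hom C Z B \<Longrightarrow> f \<cdot> x = g \<cdot> y \<Longrightarrow>
      \<exists>u \<in> hom C Z P. a \<cdot> u = x \<and> b \<cdot> u = y"
    and "\<And>Z u v. u \<in> hom C Z P \<Longrightarrow> v \<in> hom C Z P \<Longrightarrow> a \<cdot> u = a \<cdot> v \<Longrightarrow>
      b \<cdot> u = b \<cdot> v \<Longrightarrow> u = v"
  shows "pullback C f g a b"
  unfolding pullback_def
  apply (rule exI[of _ P], rule exI[of _ A], rule exI[of _ B], rule exI[of _ D])
  using assms by (auto simp: Ex1_def) metis

text \<open>A monic has a trivial kernel pair; this is what keeps a kernel unchanged when a
  subobject is intersected with itself.\<close>

lemma pullback_monic_Id:
  assumes "monic C m" "m \<in> hom C A B"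
  shows "pullback C m m (Id C A) (Id C A)"
proof -
  note [simp] = hom_obj(1)[OF assms(2)] assms(2)[unfolded hom_iff]
  show ?thesis
  proof (rule pullbackI[OF assms(2) assms(2)])
    fix Z x y assume "x \<in> hom C Z A" "y \<in> hom C Z A" "m \<cdot> x = m \<cdot> y"
    moreover from this have "x = y" using monicD[OF assms(1), of x y Z] by simp
    ultimately show "\<exists>u\<in>hom C Z A. Id C A \<cdot> u = x \<and> Id C A \<cdot> u = y"
      by (auto simp: hom_iff)
  qed (auto simp: hom_iff)
qed

lemma pullback_Id_left:
  assumes "f \<in> hom C A B"
  shows "pullback C (Id C B) f f (Id C A)"
proof -
  note [simp] = hom_obj[OF assms] assms[unfolded hom_iff]
  show ?thesis
    by (rule pullbackI[where D = B and A = B and B = A and P = A]) (auto simp: hom_iff)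
qed

lemma pullback_Id_right:
  assumes "f \<in> hom C A B"
  shows "pullback C f (Id C B) (Id C A) f"
proof -
  note [simp] = hom_obj[OF assms] assms[unfolded hom_iff]
  show ?thesis
    by (rule pullbackI[where D = B and A = A and B = B and P = A]) (auto simp: hom_iff)
qed

section \<open>Coequalizers and regular epimorphisms\<close>

lemma coequalizer_hom:
  assumes "coequalizer C f g q"
  shows "q \<in> hom C (Dom C q) (Cod C q)" "f \<in> hom C (Dom C f) (Dom C q)"
    "g \<in> hom C (Dom C f) (Dom C q)" "q \<cdot> f = q \<cdot> g"
  using assms by (auto simp: coequalizer_def hom_iff)

lemma coequalizer_univ:
  assumes "coequalizer C f g q" "z \<in> hom C (Dom C q) Z" "z \<cdot> f = z \<cdot> g"
  shows "\<exists>!u. u \<in> hom C (Cod C q) Z \<and> u \<cdot> q = z"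
proof -
  obtain A Q where "q \<in> hom C A Q"
    and univ: "\<forall>Z. \<forall>z \<in> hom C A Z. z \<cdot> f = z \<cdot> g \<longrightarrow>
           (\<exists>!u. u \<in> hom C Q Z \<and> u \<cdot> q = z)"
    using assms(1) unfolding coequalizer_def by blast
  then have "A = Dom C q" "Q = Cod C q" by (auto simp: hom_iff)
  with univ assms(2-) show ?thesis by blast
qed

lemma coequalizer_factor:
  assumes "coequalizer C f g q" "q \<in> hom C A Q" "z \<in> hom C A Z" "z \<cdot> f = z \<cdot> g"
  obtains u where "u \<in> hom C Q Z" "u \<cdot> q = z"
  using coequalizer_univ[OF assms(1), of z Z] assms(2-) by (auto simp: hom_iff)

lemma coequalizer_epi:
  assumes "coequalizer C f g q" "u \<in> hom C (Cod C q) Z" "v \<in> hom C (Cod C q) Z"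
    "u \<cdot> q = v \<cdot> q"
  shows "u = v"
proof -
  note h = coequalizer_hom[OF assms(1)]
  have "u \<cdot> q \<in> hom C (Dom C q) Z"
    using h assms by (auto simp: hom_iff)
  moreover have "(u \<cdot> q) \<cdot> f = (u \<cdot> q) \<cdot> g"
    using h assms(2) by (simp add: hom_iff)
  ultimately show ?thesis using coequalizer_univ[OF assms(1)] assms(2-) by metis
qed

lemma coequalizerI:
  assumes "f \<in> hom C R A" "g \<in> hom C R A" "q \<in> hom C A Q" "q \<cdot> f = q \<cdot> g"
    and "\<And>Z z. z \<in> hom C A Z \<Longrightarrow> z \<cdot> f = z \<cdot> g \<Longrightarrow> \<exists>u \<in> hom C Q Z. u \<cdot> q = z"
    and "\<And>Z u v. u \<in> hom C Q Z \<Longrightarrow> v \<in> hom C Q Z \<Longrightarrow> u \<cdot> q = v \<cdot> q \<Longrightarrow> u = v"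
  shows "coequalizer C f g q"
  unfolding coequalizer_def
  apply (rule exI[of _ R], rule exI[of _ A], rule exI[of _ Q])
  using assms by (auto simp: Ex1_def) metis

lemma regular_epi_epi:
  assumes "regular_epi C q" "u \<in> hom C (Cod C q) Z" "v \<in> hom C (Cod C q) Z"
    "u \<cdot> q = v \<cdot> q"
  shows "u = v"
  using assms coequalizer_epi unfolding regular_epi_def by blast

text \<open>A retraction coequalizes the idempotent \<open>s \<cdot> e\<close> and the identity, and
  any \<open>z\<close> doing the same factors as \<open>(z \<cdot> s) \<cdot> e\<close>.\<close>

lemma split_epi_regular:
  assumes "e \<in> hom C A B" "s \<in> hom C B A" "e \<cdot> s = Id C B"
  shows "regular_epi C e"
proof -
  note [simp] = hom_obj[OF assms(1)] assms(1,2)[unfolded hom_iff]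
  note [simp] = assms(3) comp_reassoc[OF assms(3)]
  have "coequalizer C (s \<cdot> e) (Id C A) e"
  proof (rule coequalizerI[where R = A and A = A and Q = B])
    fix Z z assume "z \<in> hom C A Z" "z \<cdot> (s \<cdot> e) = z \<cdot> Id C A"
    then show "\<exists>u\<in>hom C B Z. u \<cdot> e = z"
      by (intro bexI[of _ "z \<cdot> s"]) (auto simp: hom_iff)
  next
    fix Z u v assume "u \<in> hom C B Z" "v \<in> hom C B Z" "u \<cdot> e = v \<cdot> e"
    then have "(u \<cdot> e) \<cdot> s = (v \<cdot> e) \<cdot> s" by simp
    with \<open>u \<in> _\<close> \<open>v \<in> _\<close> show "u = v" by (auto simp: hom_iff)
  qed (auto simp: hom_iff)
  then show ?thesis by (auto simp: regular_epi_def)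
qed

text \<open>Cancelling \<open>m\<close> shows that \<open>e\<close> identifies the pair coequalized
  by \<open>m \<cdot> e\<close>; the resulting factorisation \<open>u\<close> of \<open>e\<close> is
  the inverse of \<open>m\<close>.\<close>

lemma regular_epi_monic_iso:
  assumes "regular_epi C (m \<cdot> e)" "monic C m" "e \<in> hom C A I" "m \<in> hom C I B"
  shows "isomorphism C m"
proof -
  note [simp] = hom_obj[OF assms(3)] hom_obj[OF assms(4)] assms(3,4)[unfolded hom_iff]
  obtain f g where c: "coequalizer C f g (m \<cdot> e)" using assms(1) by (auto simp: regular_epi_def)
  note h = coequalizer_hom[OF c]
  have [simp]: "f \<in> Arr C" "g \<in> Arr C" "Cod C f = A" "Cod C g = A" "Dom C g = Dom C f"
    using h by (auto simp: hom_iff)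
  have "e \<cdot> f = e \<cdot> g"
    by (rule monicD[OF assms(2), where Z = "Dom C f"]) (use h(4) in \<open>auto simp: hom_iff\<close>)
  then obtain u where u: "u \<in> hom C B I" and ue: "u \<cdot> (m \<cdot> e) = e"
    using coequalizer_factor[OF c _ assms(3)] by (auto simp: hom_iff)
  note [simp] = u[unfolded hom_iff]
  have mu: "m \<cdot> u = Id C B"
    by (rule coequalizer_epi[OF c, where Z = B]) (auto simp: hom_iff ue)
  have "u \<cdot> m = Id C I"
    by (rule monicD[OF assms(2), where Z = I]) (auto simp: hom_iff comp_reassoc[OF mu])
  with mu u show ?thesis unfolding isomorphism_def
    by (intro conjI bexI[of _ u]) (auto simp: hom_iff)
qed

text \<open>The pair defining \<open>e\<close> is identified by \<open>m \<cdot> e\<close>, so it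
  factors through \<open>(a, b)\<close>. Using the kernel pair of the composite lets one start from
  the kernel pair of an arrow into a faithful extension and still factor through its image.\<close>

lemma regular_epi_factor:
  assumes "regular_epi C e" "e \<in> hom C A I" "m \<in> hom C I B" "pullback C (m \<cdot> e) (m \<cdot> e) a b"
    "z \<in> hom C A Z" "z \<cdot> a = z \<cdot> b"
  obtains u where "u \<in> hom C I Z" "u \<cdot> e = z"
proof -
  note [simp] = assms(2,3,5)[unfolded hom_iff]
  define P where "P = Dom C a"
  have a: "a \<in> hom C P A" and b: "b \<in> hom C P A"
    using pullback_hom[OF assms(4)] by (auto simp: hom_iff P_def)
  note [simp] = a[unfolded hom_iff] b[unfolded hom_iff]
  obtain f g where c: "coequalizer C f g e" using assms(1) by (auto simp: regular_epi_def)
  define R where "R = Dom C f"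
  have f: "f \<in> hom C R A" and g: "g \<in> hom C R A" and efg: "e \<cdot> f = e \<cdot> g"
    using coequalizer_hom[OF c] by (auto simp: hom_iff R_def)
  note [simp] = f[unfolded hom_iff] g[unfolded hom_iff]
  have "(m \<cdot> e) \<cdot> f = (m \<cdot> e) \<cdot> g" using efg by simp
  then obtain w where w: "w \<in> hom C R P" "a \<cdot> w = f" "b \<cdot> w = g"
    using pullback_factor[OF assms(4) a b f g] by blast
  note [simp] = w(1)[unfolded hom_iff]
  have "z \<cdot> f = z \<cdot> g"
    unfolding w(2,3)[symmetric] using comp_reassoc[OF assms(6), of w] by simp
  then show thesis using coequalizer_factor[OF c assms(2,5)] that by blast
qed

lemma isomorphism_Id:
  assumes "A \<in> Obj C"
  shows "isomorphism C (Id C A)"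
  using assms by (auto simp: isomorphism_def hom_iff intro!: bexI[of _ "Id C A"])

lemma isomorphismE:
  assumes "isomorphism C f" "f \<in> hom C A B"
  obtains g where "g \<in> hom C B A" "g \<cdot> f = Id C A" "f \<cdot> g = Id C B"
  using assms by (auto simp: isomorphism_def hom_iff)

end

section \<open>Zero arrows, kernels and cokernels\<close>

context pointed_category
begin

text \<open>The definite description is legitimate because composites through two zero objects are
  related by the comparison arrow \<open>w\<close>.\<close>

lemma zero_arr_eq:
  assumes Z: "zero_object C Z" and u: "u \<in> hom C A Z" and v: "v \<in> hom C Z B"
  shows "zero_arr C A B = v \<cdot> u"
  unfolding zero_arr_def
proof (rule the_equality)
  show "\<exists>Z u' v'. zero_object C Z \<and> u' \<in> hom C A Z \<and> v' \<in> hom C Z B \<and> v \<cdot> u = v' \<cdot> u'"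
    using assms by blast
next
  fix f assume "\<exists>Z u v. zero_object C Z \<and> u \<in> hom C A Z \<and> v \<in> hom C Z B \<and> f = v \<cdot> u"
  then obtain Y x y where Y: "zero_object C Y" and x: "x \<in> hom C A Y"
    and y: "y \<in> hom C Y B" and f: "f = y \<cdot> x" by blast
  have "Y \<in> Obj C" using Y by (simp add: zero_object_def)
  then obtain w where w: "w \<in> hom C Z Y" using Z by (auto simp: zero_object_def)
  note [simp] = u[unfolded hom_iff] v[unfolded hom_iff] x[unfolded hom_iff]
    y[unfolded hom_iff] w[unfolded hom_iff]
  have obj: "A \<in> Obj C" "B \<in> Obj C" using hom_obj[OF u] hom_obj[OF v] by auto
  have "w \<cdot> u = x" using Y obj x by (auto simp: zero_object_def hom_iff)
  moreover have "y \<cdot> w = v" using Z obj v by (auto simp: zero_object_def hom_iff)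
  ultimately show "f = v \<cdot> u" using f by auto
qed

lemma zero_arr_factor:
  assumes "A \<in> Obj C" "B \<in> Obj C"
  obtains Z u v where "zero_object C Z" "u \<in> hom C A Z" "v \<in> hom C Z B" "zero_arr C A B = v \<cdot> u"
proof -
  obtain Z where Z: "zero_object C Z" using ex_zero by blast
  then have "\<exists>!v. v \<in> hom C Z B" "\<exists>!u. u \<in> hom C A Z"
    using assms by (auto simp: zero_object_def)
  then obtain u v where "u \<in> hom C A Z" "v \<in> hom C Z B" by auto
  then show thesis using that Z zero_arr_eq by blast
qed

lemma zero_arr_hom [simp]:
  assumes "A \<in> Obj C" "B \<in> Obj C"
  shows "zero_arr C A B \<in> Arr C" "Dom C (zero_arr C A B) = A" "Cod C (zero_arr C A B) = B"
  by (rule zero_arr_factor[OF assms]; auto simp: hom_iff)+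

lemma comp_zero [simp]:
  assumes "f \<in> Arr C" "A \<in> Obj C" "Dom C f = B"
  shows "f \<cdot> zero_arr C A B = zero_arr C A (Cod C f)"
proof -
  have "B \<in> Obj C" using assms dom_obj by auto
  obtain Z u v where Z: "zero_object C Z" and u: "u \<in> hom C A Z" and v: "v \<in> hom C Z B"
    and z: "zero_arr C A B = v \<cdot> u"
    using zero_arr_factor[OF assms(2) \<open>B \<in> Obj C\<close>] by metis
  have "f \<cdot> v \<in> hom C Z (Cod C f)" using v assms by (auto simp: hom_iff)
  from zero_arr_eq[OF Z u this] show ?thesis using z u v assms by (auto simp: hom_iff)
qed

lemma zero_comp [simp]:
  assumes "f \<in> Arr C" "B \<in> Obj C" "Cod C f = A"
  shows "zero_arr C A B \<cdot> f = zero_arr C (Dom C f) B"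
proof -
  have "A \<in> Obj C" using assms cod_obj by auto
  obtain Z u v where Z: "zero_object C Z" and u: "u \<in> hom C A Z" and v: "v \<in> hom C Z B"
    and z: "zero_arr C A B = v \<cdot> u"
    using zero_arr_factor[OF \<open>A \<in> Obj C\<close> assms(2)] by metis
  have "u \<cdot> f \<in> hom C (Dom C f) Z" using u assms by (auto simp: hom_iff)
  from zero_arr_eq[OF Z this v] show ?thesis using z u v assms by (auto simp: hom_iff)
qed

lemma kernel_hom:
  assumes "kernel C f k"
  shows "f \<in> hom C (Dom C f) (Cod C f)" "k \<in> hom C (Dom C k) (Dom C f)"
    "f \<cdot> k = zero_arr C (Dom C k) (Cod C f)"
  using assms by (auto simp: kernel_def hom_iff)

lemma kernel_univ:
  assumes "kernel C f k" "z \<in> hom C Z (Dom C f)" "f \<cdot> z = zero_arr C Z (Cod C f)"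
  shows "\<exists>!u. u \<in> hom C Z (Dom C k) \<and> k \<cdot> u = z"
proof -
  obtain K A B where "f \<in> hom C A B" "k \<in> hom C K A"
    and univ: "\<forall>Z. \<forall>z \<in> hom C Z A. f \<cdot> z = zero_arr C Z B \<longrightarrow>
           (\<exists>!u. u \<in> hom C Z K \<and> k \<cdot> u = z)"
    using assms(1) unfolding kernel_def by blast
  then have "A = Dom C f" "B = Cod C f" "K = Dom C k" by (auto simp: hom_iff)
  with univ assms(2-) show ?thesis by blast
qed

lemma kernel_factor:
  assumes "kernel C f k" "f \<in> hom C A B" "k \<in> hom C K A"
    "z \<in> hom C Z A" "f \<cdot> z = zero_arr C Z B"
  obtains u where "u \<in> hom C Z K" "k \<cdot> u = z"
  using kernel_univ[OF assms(1), of z Z] assms(2-) by (auto simp: hom_iff)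

lemma kernel_monic:
  assumes "kernel C f k"
  shows "monic C k"
proof (rule monicI[OF kernel_hom(2)[OF assms]])
  note h = kernel_hom[OF assms]
  fix Z u v assume u: "u \<in> hom C Z (Dom C k)" and v: "v \<in> hom C Z (Dom C k)"
    and e: "k \<cdot> u = k \<cdot> v"
  have o: "Dom C k \<in> Obj C" "Cod C f \<in> Obj C" using h hom_obj by blast+
  have "k \<cdot> u \<in> hom C Z (Dom C f)"
    using h u by (auto simp: hom_iff)
  moreover have "f \<cdot> (k \<cdot> u) = zero_arr C Z (Cod C f)"
    using comp_reassoc[OF h(3), of u] h u o by (simp add: hom_iff)
  ultimately show "u = v" using kernel_univ[OF assms] u v e by metis
qed

lemma kernelI:
  assumes "f \<in> hom C A B" "k \<in> hom C K A" "f \<cdot> k = zero_arr C K B"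
    and "\<And>Z z. z \<in> hom C Z A \<Longrightarrow> f \<cdot> z = zero_arr C Z B \<Longrightarrow> \<exists>u \<in> hom C Z K. k \<cdot> u = z"
    and "\<And>Z u v. u \<in> hom C Z K \<Longrightarrow> v \<in> hom C Z K \<Longrightarrow> k \<cdot> u = k \<cdot> v \<Longrightarrow> u = v"
  shows "kernel C f k"
  unfolding kernel_def
  apply (rule exI[of _ K], rule exI[of _ A], rule exI[of _ B])
  using assms by (auto simp: Ex1_def) metis

text \<open>A cokernel of \<open>f\<close> is a coequalizer of \<open>f\<close> and the zero
  arrow.\<close>

lemma cokernel_regular_epi:
  assumes "cokernel C f q"
  shows "regular_epi C q"
proof -
  obtain A B Q where f: "f \<in> hom C A B" and q: "q \<in> hom C B Q"
    and qf: "q \<cdot> f = zero_arr C A Q"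
    and univ: "\<And>Z z. z \<in> hom C B Z \<Longrightarrow> z \<cdot> f = zero_arr C A Z \<Longrightarrow>
      \<exists>!u. u \<in> hom C Q Z \<and> u \<cdot> q = z"
    using assms unfolding cokernel_def by blast
  note [simp] = f[unfolded hom_iff] q[unfolded hom_iff] hom_obj[OF f] hom_obj[OF q]
  have "coequalizer C f (zero_arr C A B) q"
  proof (rule coequalizerI[where R = A and A = B and Q = Q])
    fix Z u v assume uv: "u \<in> hom C Q Z" "v \<in> hom C Q Z" "u \<cdot> q = v \<cdot> q"
    have "u \<cdot> q \<in> hom C B Z" "(u \<cdot> q) \<cdot> f = zero_arr C A Z"
      using uv(1) by (auto simp: hom_iff qf)
    from univ[OF this] show "u = v" using uv by metis
  next
    fix Z z assume z: "z \<in> hom C B Z" "z \<cdot> f = z \<cdot> zero_arr C A B"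
    then have "z \<cdot> f = zero_arr C A Z" by (auto simp: hom_iff)
    from univ[OF z(1) this] show "\<exists>u\<in>hom C Q Z. u \<cdot> q = z" by blast
  qed (auto simp: hom_iff qf)
  then show ?thesis by (auto simp: regular_epi_def)
qed

text \<open>Protomodularity is phrased with pullbacks along an arbitrary arrow; reading a kernel as
  the pullback along \<open>0 \<rightarrow> B\<close> makes it applicable to kernels.\<close>

lemma kernel_pullback:
  assumes "kernel C f k" "zero_object C Z" "f \<in> hom C A B" "k \<in> hom C K A"
    "v \<in> hom C Z B" "w \<in> hom C K Z"
  shows "pullback C f v k w"
proof -
  note [simp] = assms(3-6)[unfolded hom_iff]
  have fk: "f \<cdot> k = zero_arr C K B" using kernel_hom(3)[OF assms(1)] by simp
  have zz: "x = y" if "x \<in> hom C Y Z" "y \<in> hom C Y Z" for x y Y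
    using that assms(2) hom_obj(1)[OF that(1)] unfolding zero_object_def by blast
  show ?thesis
  proof (rule pullbackI[OF assms(3,5,4,6)])
    show "f \<cdot> k = v \<cdot> w" using zero_arr_eq[OF assms(2,6,5)] fk by simp
  next
    fix Y x y assume x: "x \<in> hom C Y A" and y: "y \<in> hom C Y Z" and e: "f \<cdot> x = v \<cdot> y"
    then have "f \<cdot> x = zero_arr C Y B" using zero_arr_eq[OF assms(2) y assms(5)] by simp
    then obtain u where u: "u \<in> hom C Y K" "k \<cdot> u = x"
      using kernel_factor[OF assms(1,3,4) x] by blast
    moreover have "w \<cdot> u = y" by (rule zz[of _ Y]) (use u y in \<open>auto simp: hom_iff\<close>)
    ultimately show "\<exists>u\<in>hom C Y K. k \<cdot> u = x \<and> w \<cdot> u = y" by blast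
  next
    fix Y x y assume "x \<in> hom C Y K" "y \<in> hom C Y K" "k \<cdot> x = k \<cdot> y"
    then show "x = y" using monicD[OF kernel_monic[OF assms(1)], of x y Y] by simp
  qed
qed

end

section \<open>Kernels, equalizers and images in a regular category\<close>

context regular_category
begin

lemma ex_kernel:
  assumes "f \<in> hom C A B"
  obtains K k where "k \<in> hom C K A" "kernel C f k"
proof -
  note o = hom_obj[OF assms]
  obtain Z where Z: "zero_object C Z" using ex_zero by blast
  then obtain v where v: "v \<in> hom C Z B" using o by (auto simp: zero_object_def)
  obtain k w where p: "pullback C f v k w" using ex_pullback[OF assms v] by blast
  note [simp] = assms[unfolded hom_iff] v[unfolded hom_iff] o
  define K where "K = Dom C k"
  have k: "k \<in> hom C K A" and w: "w \<in> hom C K Z" and e: "f \<cdot> k = v \<cdot> w"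
    using pullback_hom[OF p] by (auto simp: hom_iff K_def)
  note [simp] = k[unfolded hom_iff] w[unfolded hom_iff]
  have "kernel C f k"
  proof (rule kernelI[OF assms k])
    show "f \<cdot> k = zero_arr C K B" using zero_arr_eq[OF Z w v] e by simp
  next
    fix Y z assume z: "z \<in> hom C Y A" "f \<cdot> z = zero_arr C Y B"
    obtain y where y: "y \<in> hom C Y Z"
      using Z hom_obj(1)[OF z(1)] by (auto simp: zero_object_def)
    have "f \<cdot> z = v \<cdot> y" using zero_arr_eq[OF Z y v] z by simp
    then show "\<exists>u\<in>hom C Y K. k \<cdot> u = z"
      using pullback_factor[OF p k w z(1) y] by blast
  next
    fix Y x y assume x: "x \<in> hom C Y K" and y: "y \<in> hom C Y K" and e: "k \<cdot> x = k \<cdot> y"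
    have "w \<cdot> x \<in> hom C Y Z" "w \<cdot> y \<in> hom C Y Z" using x y by (auto simp: hom_iff)
    then have "w \<cdot> x = w \<cdot> y"
      using Z hom_obj(1)[OF x] unfolding zero_object_def by blast
    with x y e show "x = y" using pullback_eqI[OF p k] by blast
  qed
  with k show thesis using that by blast
qed

text \<open>The product of \<open>W\<close> and \<open>P\<close> is their pullback over the zero
  object, which is terminal. The equalizer of \<open>x\<close> and \<open>y\<close> is the
  intersection of their graphs \<open>gx\<close> and \<open>gy\<close> in this product.\<close>

lemma ex_equalizer:
  assumes "x \<in> hom C W P" "y \<in> hom C W P"
  obtains E e where "e \<in> hom C E W" "monic C e" "x \<cdot> e = y \<cdot> e"
    "\<And>Z z. z \<in> hom C Z W \<Longrightarrow> x \<cdot> z = y \<cdot> z \<Longrightarrow> \<exists>u \<in> hom C Z E. e \<cdot> u = z"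
proof -
  note o = hom_obj[OF assms(1)]
  obtain T where T: "zero_object C T" using ex_zero by blast
  then have "\<exists>!s. s \<in> hom C W T" "\<exists>!t. t \<in> hom C P T"
    using o by (auto simp: zero_object_def)
  then obtain s t where s: "s \<in> hom C W T" and t: "t \<in> hom C P T" by auto
  have uniq: "c = d" if "c \<in> hom C Y T" "d \<in> hom C Y T" for c d Y
    using that T hom_obj(1)[OF that(1)] unfolding zero_object_def by blast
  obtain a b where p: "pullback C s t a b" using ex_pullback[OF s t] by blast
  define Q where "Q = Dom C a"
  note [simp] = assms[unfolded hom_iff] s[unfolded hom_iff] t[unfolded hom_iff] o
  have a: "a \<in> hom C Q W" and b: "b \<in> hom C Q P"
    using pullback_hom[OF p] by (auto simp: hom_iff Q_def)
  note [simp] = a[unfolded hom_iff] b[unfolded hom_iff]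
  have graph: "\<exists>u. u \<in> hom C W Q \<and> a \<cdot> u = Id C W \<and> b \<cdot> u = z" if z: "z \<in> hom C W P" for z
  proof -
    have "s \<cdot> Id C W = t \<cdot> z"
      by (rule uniq[of _ W]) (use z in \<open>auto simp: hom_iff\<close>)
    then show ?thesis
      using pullback_factor[OF p a b id_hom z] by (metis o(1))
  qed
  obtain gx where gx: "gx \<in> hom C W Q" "a \<cdot> gx = Id C W" "b \<cdot> gx = x" using graph[OF assms(1)] by blast
  obtain gy where gy: "gy \<in> hom C W Q" "a \<cdot> gy = Id C W" "b \<cdot> gy = y" using graph[OF assms(2)] by blast
  note [simp] = gx(1)[unfolded hom_iff] gy(1)[unfolded hom_iff]
  note r = gx(2,3)[THEN comp_reassoc] gy(2,3)[THEN comp_reassoc]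
  obtain e d where q: "pullback C gx gy e d" using ex_pullback[OF gx(1) gy(1)] by blast
  define E where "E = Dom C e"
  have e: "e \<in> hom C E W" and d: "d \<in> hom C E W" and eq: "gx \<cdot> e = gy \<cdot> d"
    using pullback_hom[OF q] by (auto simp: hom_iff E_def)
  note [simp] = e[unfolded hom_iff] d[unfolded hom_iff]
  \<comment> \<open>The first projection forces the two legs of the intersection to coincide; the
    second then says that this leg equalizes \<open>x\<close> and \<open>y\<close>.\<close>
  have "a \<cdot> (gx \<cdot> e) = a \<cdot> (gy \<cdot> d)" "b \<cdot> (gx \<cdot> e) = b \<cdot> (gy \<cdot> d)" using eq by simp_all
  then have ed: "d = e" and xy: "x \<cdot> e = y \<cdot> e" by (simp_all add: r)
  show thesis
  proof (rule that[OF e _ xy])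
    show "monic C e"
    proof (rule monicI[OF e])
      fix Z u v assume "u \<in> hom C Z E" "v \<in> hom C Z E" "e \<cdot> u = e \<cdot> v"
      then show "u = v" using pullback_eqI[OF q e] ed by blast
    qed
  next
    fix Z z assume z: "z \<in> hom C Z W" "x \<cdot> z = y \<cdot> z"
    have "gx \<cdot> z = gy \<cdot> z"
      by (rule pullback_eqI[OF p a, where Z = Z]) (use z in \<open>auto simp: hom_iff r\<close>)
    then show "\<exists>u\<in>hom C Z E. e \<cdot> u = z"
      using pullback_factor[OF q e d z(1) z(1)] by metis
  qed
qed

text \<open>The regular epimorphism is the coequalizer of the given kernel pair, so a caller knows
  which pair it coequalizes. Monicity of \<open>m\<close> relies on pullback stability: arrows into
  \<open>I\<close> lift to \<open>A\<close> only after their domain has been covered.\<close>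

lemma ex_image_factorisation:
  assumes f: "f \<in> hom C A B" and p: "pullback C f f a b"
  obtains I e m where "e \<in> hom C A I" "m \<in> hom C I B" "coequalizer C a b e" "monic C m"
    "f = m \<cdot> e"
proof -
  obtain e where c: "coequalizer C a b e" using ex_coeq_kernel_pair[OF p] by blast
  note [simp] = f[unfolded hom_iff]
  define P where "P = Dom C a"
  have a: "a \<in> hom C P A" and b: "b \<in> hom C P A" and fab: "f \<cdot> a = f \<cdot> b"
    using pullback_hom[OF p] by (auto simp: hom_iff P_def)
  note [simp] = a[unfolded hom_iff] b[unfolded hom_iff]
  define I where "I = Cod C e"
  have e: "e \<in> hom C A I" and eab: "e \<cdot> a = e \<cdot> b"
    using coequalizer_hom[OF c] by (auto simp: hom_iff I_def)
  note [simp] = e[unfolded hom_iff]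
  obtain m where m: "m \<in> hom C I B" and f_eq: "m \<cdot> e = f"
    using coequalizer_factor[OF c e f fab] by blast
  note [simp] = m[unfolded hom_iff]
  have re: "regular_epi C e" using c by (auto simp: regular_epi_def)
  have "monic C m"
  proof (rule monicI[OF m])
    fix Z x y assume x: "x \<in> hom C Z I" and y: "y \<in> hom C Z I" and xy: "m \<cdot> x = m \<cdot> y"
    note [simp] = x[unfolded hom_iff] y[unfolded hom_iff]
    txt \<open>Lift \<open>x\<close> and \<open>y\<close> along \<open>e\<close>, after covering their domain twice by pullbacks of \<open>e\<close>.\<close>
    obtain x' z1 where p1: "pullback C e x x' z1" using ex_pullback[OF e x] by blast
    define Z1 where "Z1 = Dom C x'"
    have x': "x' \<in> hom C Z1 A" and z1: "z1 \<in> hom C Z1 Z" and ex: "e \<cdot> x' = x \<cdot> z1"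
      using pullback_hom[OF p1] by (auto simp: hom_iff Z1_def)
    have r1: "regular_epi C z1" using regular_epi_stable[OF p1 re] .
    note [simp] = x'[unfolded hom_iff] z1[unfolded hom_iff]
    have yz: "y \<cdot> z1 \<in> hom C Z1 I" by (simp add: hom_iff)
    obtain y' z2 where p2: "pullback C e (y \<cdot> z1) y' z2" using ex_pullback[OF e yz] by blast
    define Z2 where "Z2 = Dom C y'"
    have y': "y' \<in> hom C Z2 A" and z2: "z2 \<in> hom C Z2 Z1" and ey: "e \<cdot> y' = (y \<cdot> z1) \<cdot> z2"
      using pullback_hom[OF p2] by (auto simp: hom_iff Z2_def)
    have r2: "regular_epi C z2" using regular_epi_stable[OF p2 re] .
    note [simp] = y'[unfolded hom_iff] z2[unfolded hom_iff]
    \<comment> \<open>The two lifts agree under \<open>f\<close>, so they factor through the kernel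
      pair \<open>(a, b)\<close>, whose legs \<open>e\<close> identifies; the covers are cancelled
      afterwards.\<close>
    have "f \<cdot> (x' \<cdot> z2) = m \<cdot> (x \<cdot> (z1 \<cdot> z2))"
      unfolding f_eq[symmetric] by (simp add: comp_reassoc[OF ex])
    also have "\<dots> = m \<cdot> (y \<cdot> (z1 \<cdot> z2))"
      by (simp add: comp_reassoc[OF xy])
    also have "\<dots> = f \<cdot> y'" unfolding f_eq[symmetric] by (simp add: ey)
    finally have "f \<cdot> (x' \<cdot> z2) = f \<cdot> y'" .
    then obtain w where w: "w \<in> hom C Z2 P" "a \<cdot> w = x' \<cdot> z2" "b \<cdot> w = y'"
      using pullback_factor[OF p a b comp_hom[OF z2 x'] y'] by blast
    note [simp] = w(1)[unfolded hom_iff]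
    have "e \<cdot> (a \<cdot> w) = e \<cdot> (b \<cdot> w)" by (simp add: comp_reassoc[OF eab])
    then have *: "(x \<cdot> z1) \<cdot> z2 = (y \<cdot> z1) \<cdot> z2"
      by (simp add: w(2,3) comp_reassoc[OF ex] ey)
    have "x \<cdot> z1 = y \<cdot> z1"
      by (rule regular_epi_epi[OF r2 _ _ *]) (auto simp: hom_iff)
    then show "x = y"
      using regular_epi_epi[OF r1, of x I y] x y by simp
  qed
  then show thesis using that e m c f_eq by blast
qed

end

section \<open>Split extensions\<close>

context pointed_category
begin

lemma SplExtD:
  assumes "E \<in> SplExt C K"
  shows "proj E \<in> hom C (total C E) (base C E)" "sect E \<in> hom C (base C E) (total C E)"
    "incl E \<in> hom C K (total C E)"
    "proj E \<cdot> sect E = Id C (base C E)" "proj E \<cdot> incl E = zero_arr C K (base C E)"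
    "kernel C (proj E) (incl E)"
  using assms kernel_hom[of "proj E" "incl E"]
  by (auto simp: SplExt_def point_def hom_iff base_def)

lemma SplExtI:
  assumes "p \<in> hom C A B" "s \<in> hom C B A" "p \<cdot> s = Id C B" "k \<in> hom C K A" "kernel C p k"
  shows "\<lparr>proj = p, sect = s, incl = k\<rparr> \<in> SplExt C K"
    "base C \<lparr>proj = p, sect = s, incl = k\<rparr> = B" "total C \<lparr>proj = p, sect = s, incl = k\<rparr> = A"
  using assms by (auto simp: SplExt_def point_def hom_iff base_def total_def)

lemma splext_morI:
  assumes "E \<in> SplExt C X" "F \<in> SplExt C Y" "x \<in> hom C X Y"
    "g \<in> hom C (base C E) (base C F)" "f \<in> hom C (total C E) (total C F)"
    "incl F \<cdot> x = f \<cdot> incl E" "proj F \<cdot> f = g \<cdot> proj E" "f \<cdot> sect E = sect F \<cdot> g"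
  shows "splext_mor C E F x g f"
  using assms by (auto simp: splext_mor_def hom_iff)

lemma splext_morD:
  assumes "splext_mor C E F x g f" "E \<in> SplExt C X" "F \<in> SplExt C Y"
  shows "x \<in> hom C X Y" "g \<in> hom C (base C E) (base C F)" "f \<in> hom C (total C E) (total C F)"
    "incl F \<cdot> x = f \<cdot> incl E" "proj F \<cdot> f = g \<cdot> proj E" "f \<cdot> sect E = sect F \<cdot> g"
  using assms by (auto simp: splext_mor_def SplExt_def hom_iff)

lemma splext_mor_comp:
  assumes "splext_mor C E F x g f" "splext_mor C F G y h k"
  shows "splext_mor C E G (y \<cdot> x) (h \<cdot> g) (k \<cdot> f)"
proof -
  define X Y where "X = Dom C x" and "Y = Cod C x"
  have E: "E \<in> SplExt C X" and F: "F \<in> SplExt C Y"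
    using assms(1) by (auto simp: splext_mor_def X_def Y_def)
  define Z where "Z = Cod C y"
  have G: "G \<in> SplExt C Z" using assms(2) by (auto simp: splext_mor_def Z_def)
  note m = splext_morD[OF assms(1) E F] and n = splext_morD[OF assms(2) F G]
  note e = SplExtD[OF E] and f = SplExtD[OF F] and g = SplExtD[OF G]
  note [simp] = m(1-3)[unfolded hom_iff] n(1-3)[unfolded hom_iff]
    e(1-3)[unfolded hom_iff] f(1-3)[unfolded hom_iff] g(1-3)[unfolded hom_iff]
  show ?thesis
    by (rule splext_morI[OF E G])
      (simp_all add: hom_iff m(4-) comp_reassoc[OF n(4)] comp_reassoc[OF n(5)]
        comp_reassoc[OF n(6)])
qed

text \<open>Kernels commute with pullbacks, so a pullback of split extensions can be computed
  separately on kernels, bases and total objects. The three squares are parameters: choosing trivial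
  ones for kernels or bases pins down the kernel or the base of \<open>W\<close>.\<close>

lemma splext_pullback:
  assumes D: "D \<in> SplExt C K" and D': "D' \<in> SplExt C K'" and E: "E \<in> SplExt C L"
    and m: "splext_mor C D E x r s" and m': "splext_mor C D' E x' r' s'"
    and px: "pullback C x x' a a'" and pr: "pullback C r r' c c'" and ps: "pullback C s s' e e'"
  obtains W where "W \<in> SplExt C (Dom C a)"
    "splext_mor C W D a c e" "splext_mor C W D' a' c' e'"
proof -
  define M T P where "M = Dom C a" and "T = Dom C c" and "P = Dom C e"
  note m = splext_morD[OF m D E] and n = splext_morD[OF m' D' E]
  note d = SplExtD[OF D] and d' = SplExtD[OF D'] and ee = SplExtD[OF E]
  note [simp] = m(1-3)[unfolded hom_iff] n(1-3)[unfolded hom_iff]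
    d(1-3)[unfolded hom_iff] d'(1-3)[unfolded hom_iff] ee(1-3)[unfolded hom_iff]
  have a: "a \<in> hom C M K" "a' \<in> hom C M K'" and ea: "x \<cdot> a = x' \<cdot> a'"
    using pullback_hom[OF px] by (auto simp: hom_iff M_def)
  have c: "c \<in> hom C T (base C D)" "c' \<in> hom C T (base C D')" and ec: "r \<cdot> c = r' \<cdot> c'"
    using pullback_hom[OF pr] by (auto simp: hom_iff T_def)
  have e: "e \<in> hom C P (total C D)" "e' \<in> hom C P (total C D')" and ee': "s \<cdot> e = s' \<cdot> e'"
    using pullback_hom[OF ps] by (auto simp: hom_iff P_def)
  note [simp] = a[unfolded hom_iff] c[unfolded hom_iff] e[unfolded hom_iff]
    hom_obj[OF a(1)] hom_obj[OF c(1)] hom_obj[OF e(1)] hom_obj[OF c(2)]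
  note re = m(4-6)[symmetric, THEN comp_reassoc] n(4-6)[symmetric, THEN comp_reassoc]
  note rd = d(4,5) d'(4,5) d(4,5)[THEN comp_reassoc] d'(4,5)[THEN comp_reassoc]
  have "r \<cdot> (proj D \<cdot> e) = r' \<cdot> (proj D' \<cdot> e')"
    by (simp add: re ee')
  then obtain p where p: "p \<in> hom C P T" "c \<cdot> p = proj D \<cdot> e" "c' \<cdot> p = proj D' \<cdot> e'"
    using pullback_factor[OF pr c comp_hom[OF e(1) d(1)] comp_hom[OF e(2) d'(1)]] by blast
  have "s \<cdot> (sect D \<cdot> c) = s' \<cdot> (sect D' \<cdot> c')"
    by (simp add: comp_reassoc[OF m(6)] comp_reassoc[OF n(6)] ec)
  then obtain t where t: "t \<in> hom C T P" "e \<cdot> t = sect D \<cdot> c" "e' \<cdot> t = sect D' \<cdot> c'"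
    using pullback_factor[OF ps e comp_hom[OF c(1) d(2)] comp_hom[OF c(2) d'(2)]] by blast
  have "s \<cdot> (incl D \<cdot> a) = s' \<cdot> (incl D' \<cdot> a')"
    by (simp add: re ea)
  then obtain k where k: "k \<in> hom C M P" "e \<cdot> k = incl D \<cdot> a" "e' \<cdot> k = incl D' \<cdot> a'"
    using pullback_factor[OF ps e comp_hom[OF a(1) d(3)] comp_hom[OF a(2) d'(3)]] by blast
  note [simp] = p(1)[unfolded hom_iff] t(1)[unfolded hom_iff] k(1)[unfolded hom_iff]
  note rp = p(2,3) t(2,3) k(2,3) p(2,3)[THEN comp_reassoc] t(2,3)[THEN comp_reassoc] k(2,3)[THEN comp_reassoc]
  have pt: "p \<cdot> t = Id C T"
    by (rule pullback_eqI[OF pr c(1), of _ T]) (auto simp: hom_iff rp rd)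
  have ker: "kernel C p k"
  proof (rule kernelI[OF p(1) k(1)])
    show "p \<cdot> k = zero_arr C M T"
      by (rule pullback_eqI[OF pr c(1), of _ M]) (auto simp: hom_iff rp rd)
  next
    fix Z z assume z: "z \<in> hom C Z P" and pz: "p \<cdot> z = zero_arr C Z T"
    note [simp] = z[unfolded hom_iff] hom_obj[OF z]
    have "c \<cdot> (p \<cdot> z) = zero_arr C Z (base C D)" "c' \<cdot> (p \<cdot> z) = zero_arr C Z (base C D')"
      by (simp_all add: pz)
    then have *: "proj D \<cdot> (e \<cdot> z) = zero_arr C Z (base C D)"
      "proj D' \<cdot> (e' \<cdot> z) = zero_arr C Z (base C D')"
      by (simp_all add: rp)
    obtain w where w: "w \<in> hom C Z K" "incl D \<cdot> w = e \<cdot> z"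
      using kernel_factor[OF d(6,1,3) comp_hom[OF z e(1)] *(1)] by blast
    obtain w' where w': "w' \<in> hom C Z K'" "incl D' \<cdot> w' = e' \<cdot> z"
      using kernel_factor[OF d'(6,1,3) comp_hom[OF z e(2)] *(2)] by blast
    note [simp] = w(1)[unfolded hom_iff] w'(1)[unfolded hom_iff]
    \<comment> \<open>An arrow killed by \<open>p\<close> yields one arrow into each kernel;
      cancelling the monic \<open>incl E\<close> shows that they match over \<open>L\<close>, hence
      define an arrow into the pullback of kernels.\<close>
    have "incl E \<cdot> (x \<cdot> w) = incl E \<cdot> (x' \<cdot> w')"
      by (simp add: comp_reassoc[OF m(4)] comp_reassoc[OF n(4)] w(2) w'(2) comp_reassoc[OF ee'])
    then have "x \<cdot> w = x' \<cdot> w'"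
      by (rule monicD[OF kernel_monic[OF ee(6)], where Z = Z]) (auto simp: hom_iff)
    then obtain u where u: "u \<in> hom C Z M" "a \<cdot> u = w" "a' \<cdot> u = w'"
      using pullback_factor[OF px a w(1) w'(1)] by blast
    note [simp] = u(1)[unfolded hom_iff]
    have "k \<cdot> u = z"
      by (rule pullback_eqI[OF ps e(1), of _ Z]) (auto simp: hom_iff rp u(2,3) w(2) w'(2))
    with u(1) show "\<exists>u \<in> hom C Z M. k \<cdot> u = z" by blast
  next
    fix Z u v assume u: "u \<in> hom C Z M" and v: "v \<in> hom C Z M" and kuv: "k \<cdot> u = k \<cdot> v"
    note [simp] = u[unfolded hom_iff] v[unfolded hom_iff]
    have "e \<cdot> (k \<cdot> u) = e \<cdot> (k \<cdot> v)" "e' \<cdot> (k \<cdot> u) = e' \<cdot> (k \<cdot> v)" by (simp_all add: kuv)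
    then have *: "incl D \<cdot> (a \<cdot> u) = incl D \<cdot> (a \<cdot> v)" "incl D' \<cdot> (a' \<cdot> u) = incl D' \<cdot> (a' \<cdot> v)"
      by (simp_all add: rp)
    have "a \<cdot> u = a \<cdot> v" "a' \<cdot> u = a' \<cdot> v"
      using monicD[OF kernel_monic[OF d(6)] *(1), of Z] monicD[OF kernel_monic[OF d'(6)] *(2), of Z]
      by (simp_all add: hom_iff)
    then show "u = v" using pullback_eqI[OF px a(1) u v] by blast
  qed
  define W where "W = \<lparr>proj = p, sect = t, incl = k\<rparr>"
  note W = SplExtI[OF p(1) t(1) pt k(1) ker, folded W_def]
  have [simp]: "proj W = p" "sect W = t" "incl W = k" by (simp_all add: W_def)
  show thesis
  proof (rule that[OF W(1)[unfolded M_def]])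
    show "splext_mor C W D a c e"
      by (rule splext_morI[OF W(1) D]) (simp_all add: hom_iff W(2,3) rp)
    show "splext_mor C W D' a' c' e'"
      by (rule splext_morI[OF W(1) D']) (simp_all add: hom_iff W(2,3) rp)
  qed
qed

end

section \<open>Consequences of protomodularity for split extensions\<close>

context semi_abelian_category
begin

text \<open>This is protomodularity for the change of base along \<open>0 \<rightarrow> B\<close>.\<close>

lemma split_short_five:
  assumes E: "E \<in> SplExt C K" and F: "F \<in> SplExt C L"
    and m: "splext_mor C E F u (Id C (base C E)) f" and u: "isomorphism C u"
  shows "isomorphism C f"
proof -
  note m = splext_morD[OF m E F]
  note e = SplExtD[OF E] and f = SplExtD[OF F]
  note [simp] = m(1,3)[unfolded hom_iff] e(1-3)[unfolded hom_iff] f(1-3)[unfolded hom_iff]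
    hom_obj[OF e(1)] hom_obj[OF f(1)]
  have [simp]: "base C F = base C E" using m(2) by (simp add: hom_iff)
  obtain Z where Z: "zero_object C Z" using ex_zero by blast
  then have "\<exists>!v. v \<in> hom C Z (base C E)" "\<exists>!w. w \<in> hom C K Z" "\<exists>!w. w \<in> hom C L Z"
    using hom_obj[OF m(1)] by (auto simp: zero_object_def)
  then obtain v w w' where v: "v \<in> hom C Z (base C E)" and w: "w \<in> hom C K Z" and w': "w' \<in> hom C L Z"
    by auto
  have p: "pullback C (proj E) v (incl E) w" by (rule kernel_pullback[OF e(6) Z e(1,3) v w])
  have p': "pullback C (proj F) v (incl F) w'"
    by (rule kernel_pullback[OF f(6) Z f(1,3) _ w']) (use v in simp)
  have "w' \<cdot> u = w"
    using Z hom_obj[OF m(1)] comp_hom[OF m(1) w'] w unfolding zero_object_def by blast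
  moreover have "f \<in> pt_hom C (total C E, proj E, sect E) (total C F, proj F, sect F)"
    using m(3,5,6) by (auto simp: pt_hom_def hom_iff)
  moreover have "point C (base C E) (total C E) (proj E) (sect E)"
    "point C (base C E) (total C F) (proj F) (sect F)"
    using e f by (auto simp: point_def)
  ultimately show ?thesis
    using protomodular[unfolded protomodular_def, rule_format, of "base C E" "total C E" "proj E"
        "sect E" "total C F" "proj F" "sect F" f v "incl E" w "incl F" w' u] p p' m(1,4) u
    by (simp add: hom_iff)
qed

text \<open>The equalizer \<open>j\<close> of \<open>x\<close> and \<open>y\<close> contains both
  the section and the kernel, so its domain carries a split extension with the same base and kernel.
  By the split short five lemma \<open>j\<close> is an isomorphism.\<close>

lemma splext_jointly_epic:
  assumes E: "E \<in> SplExt C K" and x: "x \<in> hom C (total C E) P" and y: "y \<in> hom C (total C E) P"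
    and s: "x \<cdot> sect E = y \<cdot> sect E" and k: "x \<cdot> incl E = y \<cdot> incl E"
  shows "x = y"
proof -
  note e = SplExtD[OF E]
  note [simp] = e(1-3)[unfolded hom_iff] x[unfolded hom_iff] y[unfolded hom_iff]
    hom_obj[OF e(1)] hom_obj[OF e(3)]
  obtain J j where j: "j \<in> hom C J (total C E)" "monic C j" "x \<cdot> j = y \<cdot> j"
    and univ: "\<And>Z z. z \<in> hom C Z (total C E) \<Longrightarrow> x \<cdot> z = y \<cdot> z \<Longrightarrow> \<exists>u \<in> hom C Z J. j \<cdot> u = z"
    using ex_equalizer[OF x y] by metis
  note [simp] = j(1)[unfolded hom_iff]
  obtain t where t: "t \<in> hom C (base C E) J" "j \<cdot> t = sect E" using univ[OF e(2) s] by blast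
  obtain l where l: "l \<in> hom C K J" "j \<cdot> l = incl E" using univ[OF e(3) k] by blast
  note [simp] = t(1)[unfolded hom_iff] l(1)[unfolded hom_iff]
  have ker: "kernel C (proj E \<cdot> j) l"
  proof (rule kernelI[OF _ l(1)])
    fix Z z assume z: "z \<in> hom C Z J" "(proj E \<cdot> j) \<cdot> z = zero_arr C Z (base C E)"
    note [simp] = z(1)[unfolded hom_iff]
    have "proj E \<cdot> (j \<cdot> z) = zero_arr C Z (base C E)" using z(2) by simp
    then obtain u where u: "u \<in> hom C Z K" "incl E \<cdot> u = j \<cdot> z"
      using kernel_factor[OF e(6,1,3) comp_hom[OF z(1) j(1)]] by blast
    note [simp] = u(1)[unfolded hom_iff]
    have "l \<cdot> u = z"
      by (rule monicD[OF j(2), where Z = Z]) (auto simp: hom_iff comp_reassoc[OF l(2)] u(2))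
    with u(1) show "\<exists>u\<in>hom C Z K. l \<cdot> u = z" by blast
  next
    fix Z u v assume uv: "u \<in> hom C Z K" "v \<in> hom C Z K" "l \<cdot> u = l \<cdot> v"
    have "j \<cdot> (l \<cdot> u) = j \<cdot> (l \<cdot> v)" using uv(3) by simp
    then have "incl E \<cdot> u = incl E \<cdot> v" using uv(1,2) by (simp add: comp_reassoc[OF l(2)] hom_iff)
    then show "u = v" using monicD[OF kernel_monic[OF e(6)], of u v Z] uv(1,2) by simp
  qed (auto simp: hom_iff l(2) e(5))
  have pt: "(proj E \<cdot> j) \<cdot> t = Id C (base C E)" by (simp add: t(2) e(4))
  note W = SplExtI[OF comp_hom[OF j(1) e(1)] t(1) pt l(1) ker]
  have "splext_mor C \<lparr>proj = proj E \<cdot> j, sect = t, incl = l\<rparr> E (Id C K) (Id C (base C E)) j"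
    by (rule splext_morI[OF W(1) E]) (simp_all add: hom_iff W(2,3) l t)
  then have "isomorphism C j"
    using split_short_five[OF W(1) E, unfolded W(2)] isomorphism_Id by simp
  then obtain i where i: "i \<in> hom C (total C E) J" "j \<cdot> i = Id C (total C E)"
    using isomorphismE[OF _ j(1)] by metis
  have "x \<cdot> (j \<cdot> i) = y \<cdot> (j \<cdot> i)" using i(1) comp_reassoc[OF j(3), of i] by (simp add: hom_iff)
  then show ?thesis by (simp add: i(2))
qed

text \<open>The image of \<open>f\<close> is a point over the same base, whose kernel is a subobject of \<open>L\<close> through
  which the regular epimorphism \<open>a\<close> factors, hence is \<open>L\<close>; by the split short five lemma the
  image is \<open>P\<close>, so \<open>f\<close> is the coequalizer of its kernel pair.\<close>

lemma splext_mor_coequalizer: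
  assumes D: "D \<in> SplExt C K" and P: "P \<in> SplExt C L"
    and m: "splext_mor C D P a (Id C (base C D)) f" and a: "regular_epi C a"
    and p: "pullback C f f u v"
  shows "coequalizer C u v f"
proof -
  note m = splext_morD[OF m D P]
  note d = SplExtD[OF D] and q = SplExtD[OF P]
  note [simp] = m(1,3)[unfolded hom_iff] d(1-3)[unfolded hom_iff] q(1-3)[unfolded hom_iff]
    hom_obj[OF d(1)] hom_obj[OF q(1)] hom_obj[OF m(1)]
  have B [simp]: "base C P = base C D" using m(2) by (simp add: hom_iff)
  obtain I e i where e: "e \<in> hom C (total C D) I" and i: "i \<in> hom C I (total C P)"
    and c: "coequalizer C u v e" and mono: "monic C i" and f: "f = i \<cdot> e"
    using ex_image_factorisation[OF m(3) p] by metis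
  note [simp] = e[unfolded hom_iff] i[unfolded hom_iff]
  define p' where "p' = proj P \<cdot> i"
  define s' where "s' = e \<cdot> sect D"
  have p': "p' \<in> hom C I (base C D)" and s': "s' \<in> hom C (base C D) I"
    by (simp_all add: p'_def s'_def hom_iff)
  note [simp] = p'[unfolded hom_iff] s'[unfolded hom_iff]
  have pf: "proj P \<cdot> (i \<cdot> e) = proj D" using m(5) f by simp
  have ps: "p' \<cdot> s' = Id C (base C D)"
  proof -
    have "p' \<cdot> s' = (proj P \<cdot> (i \<cdot> e)) \<cdot> sect D" by (simp add: p'_def s'_def)
    then show ?thesis unfolding pf by (simp add: d(4))
  qed
  obtain M k where k: "k \<in> hom C M I" and ker: "kernel C p' k" using ex_kernel[OF p'] by blast
  note [simp] = k[unfolded hom_iff] hom_obj(1)[OF k]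
  have pk: "p' \<cdot> k = zero_arr C M (base C D)" using kernel_hom(3)[OF ker] by simp
  have "proj P \<cdot> (i \<cdot> k) = zero_arr C M (base C P)" using pk by (simp add: p'_def)
  then obtain n where n: "n \<in> hom C M L" "incl P \<cdot> n = i \<cdot> k"
    using kernel_factor[OF q(6,1,3) comp_hom[OF k i]] by blast
  note [simp] = n(1)[unfolded hom_iff]
  have "p' \<cdot> (e \<cdot> incl D) = (proj P \<cdot> (i \<cdot> e)) \<cdot> incl D" by (simp add: p'_def)
  then have "p' \<cdot> (e \<cdot> incl D) = zero_arr C K (base C D)" unfolding pf by (simp add: d(5))
  then obtain w where w: "w \<in> hom C K M" "k \<cdot> w = e \<cdot> incl D"
    using kernel_factor[OF ker p' k comp_hom[OF d(3) e]] by blast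
  note [simp] = w(1)[unfolded hom_iff]
  have "incl P \<cdot> (n \<cdot> w) = incl P \<cdot> a"
    using m(4) by (simp add: comp_reassoc[OF n(2)] w(2) f)
  then have nw: "n \<cdot> w = a"
    using monicD[OF kernel_monic[OF q(6)], of "n \<cdot> w" a K] by (simp add: hom_iff)
  have "monic C n"
  proof (rule monicI[OF n(1)])
    fix Z x y assume x: "x \<in> hom C Z M" and y: "y \<in> hom C Z M" and xy: "n \<cdot> x = n \<cdot> y"
    note [simp] = x[unfolded hom_iff] y[unfolded hom_iff]
    have "i \<cdot> (k \<cdot> x) = incl P \<cdot> (n \<cdot> x)" "i \<cdot> (k \<cdot> y) = incl P \<cdot> (n \<cdot> y)"
      by (simp_all add: comp_reassoc[OF n(2)])
    then have "i \<cdot> (k \<cdot> x) = i \<cdot> (k \<cdot> y)" using xy by simp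
    then have "k \<cdot> x = k \<cdot> y"
      using monicD[OF mono, of "k \<cdot> x" "k \<cdot> y" Z] by (simp add: hom_iff)
    then show "x = y" using monicD[OF kernel_monic[OF ker], of x y Z] by (simp add: hom_iff)
  qed
  then have iso_n: "isomorphism C n"
    using regular_epi_monic_iso[OF _ _ w(1) n(1)] a nw by simp
  define W where "W = \<lparr>proj = p', sect = s', incl = k\<rparr>"
  note W = SplExtI[OF p' s' ps k ker, folded W_def]
  have [simp]: "proj W = p'" "sect W = s'" "incl W = k" by (simp_all add: W_def)
  have "i \<cdot> s' = sect P" using m(6) by (simp add: s'_def f)
  then have "splext_mor C W P n (Id C (base C D)) i"
    by (intro splext_morI[OF W(1) P]) (simp_all add: hom_iff W(2,3) n(2) p'_def)
  then have "isomorphism C i" using split_short_five[OF W(1) P, unfolded W(2)] iso_n by blast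
  then obtain j where j: "j \<in> hom C (total C P) I" "j \<cdot> i = Id C I" "i \<cdot> j = Id C (total C P)"
    using isomorphismE[OF _ i] by metis
  note [simp] = j(1)[unfolded hom_iff]
  define Q where "Q = Dom C u"
  have uv: "u \<in> hom C Q (total C D)" "v \<in> hom C Q (total C D)" "e \<cdot> u = e \<cdot> v"
    using coequalizer_hom[OF c] by (auto simp: hom_iff Q_def)
  note [simp] = uv(1,2)[unfolded hom_iff]
  show ?thesis
  proof (rule coequalizerI[OF uv(1,2) m(3)])
    show "f \<cdot> u = f \<cdot> v" by (simp add: f uv(3))
  next
    fix Z z assume z: "z \<in> hom C (total C D) Z" "z \<cdot> u = z \<cdot> v"
    obtain y where y: "y \<in> hom C I Z" "y \<cdot> e = z" using coequalizer_factor[OF c e z] by blast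
    then have "y \<cdot> j \<in> hom C (total C P) Z" "(y \<cdot> j) \<cdot> f = z"
      by (simp_all add: hom_iff f comp_reassoc[OF j(2)])
    then show "\<exists>u\<in>hom C (total C P) Z. u \<cdot> f = z" by blast
  next
    fix Z x y assume x: "x \<in> hom C (total C P) Z" and y: "y \<in> hom C (total C P) Z"
      and xy: "x \<cdot> f = y \<cdot> f"
    note [simp] = x[unfolded hom_iff] y[unfolded hom_iff]
    have "x \<cdot> i = y \<cdot> i"
      by (rule coequalizer_epi[OF c, where Z = Z]) (use xy in \<open>auto simp: f hom_iff\<close>)
    then have "x \<cdot> (i \<cdot> j) = y \<cdot> (i \<cdot> j)" using comp_reassoc[of x i "y \<cdot> i" j] by simp
    then show "x = y" by (simp add: j(3))
  qed
qed

text \<open>Since \<open>f\<close> is the coequalizer of its kernel pair \<open>(u, v)\<close>, it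
  suffices that \<open>f'\<close> identifies \<open>u\<close> and \<open>v\<close>. The kernel and
  base parts \<open>c\<close> and \<open>r\<close> are prescribed; only the part on total objects is
  constructed.\<close>

lemma splext_mor_factor:
  assumes D: "D \<in> SplExt C K" and P: "P \<in> SplExt C L" and F: "F \<in> SplExt C M"
    and m: "splext_mor C D P a (Id C (base C D)) f" and a: "regular_epi C a"
    and n: "splext_mor C D F (c \<cdot> a) r f'" and c: "c \<in> hom C L M"
  obtains \<phi> where "splext_mor C P F c r \<phi>"
proof -
  note m' = splext_morD[OF m D P] and n' = splext_morD[OF n D F]
  note d = SplExtD[OF D] and q = SplExtD[OF P] and g = SplExtD[OF F]
  note [simp] = m'(1,3)[unfolded hom_iff] n'(1-3)[unfolded hom_iff] d(1-3)[unfolded hom_iff]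
    q(1-3)[unfolded hom_iff] g(1-3)[unfolded hom_iff] c[unfolded hom_iff]
    hom_obj[OF d(1)] hom_obj[OF q(1)] hom_obj[OF m'(1)]
  have [simp]: "base C P = base C D" using m'(2) by (simp add: hom_iff)
  obtain x y where px: "pullback C a a x y" using ex_pullback[OF m'(1) m'(1)] by blast
  obtain u v where pu: "pullback C f f u v" using ex_pullback[OF m'(3) m'(3)] by blast
  have pI: "pullback C (Id C (base C D)) (Id C (base C D)) (Id C (base C D)) (Id C (base C D))"
    by (rule pullback_Id_left[OF id_hom]) simp
  define N where "N = Dom C x"
  \<comment> \<open>The kernel pair of the whole morphism is again a split extension over the same
    base, so equality of \<open>f' \<cdot> u\<close> and \<open>f' \<cdot> v\<close> can be tested
    on its section and its kernel.\<close>
  obtain W where W: "W \<in> SplExt C N"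
    and wu: "splext_mor C W D x (Id C (base C D)) u"
    and wv: "splext_mor C W D y (Id C (base C D)) v"
    using splext_pullback[OF D D P m m px pI pu] unfolding N_def by blast
  note w = SplExtD[OF W] and wu = splext_morD[OF wu W D] and wv = splext_morD[OF wv W D]
  note [simp] = w(1-3)[unfolded hom_iff] wu(1,3)[unfolded hom_iff] wv(1,3)[unfolded hom_iff]
  have [simp]: "base C W = base C D" using wu(2) by (simp add: hom_iff)
  have xy: "a \<cdot> x = a \<cdot> y" using pullback_hom(5)[OF px] .
  have "f' \<cdot> u = f' \<cdot> v"
  proof (rule splext_jointly_epic[OF W, where P = "total C F"])
    show "(f' \<cdot> u) \<cdot> sect W = (f' \<cdot> v) \<cdot> sect W" by (simp add: wu(6) wv(6))
    have "(f' \<cdot> u) \<cdot> incl W = incl F \<cdot> (c \<cdot> (a \<cdot> x))"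
      using comp_reassoc[OF n'(4), of x] by (simp add: wu(4)[symmetric])
    also have "\<dots> = (f' \<cdot> v) \<cdot> incl W"
      using comp_reassoc[OF n'(4), of y] by (simp add: xy wv(4)[symmetric])
    finally show "(f' \<cdot> u) \<cdot> incl W = (f' \<cdot> v) \<cdot> incl W" .
  qed (simp_all add: hom_iff)
  moreover have coeq: "coequalizer C u v f"
    by (rule splext_mor_coequalizer[OF D P m a pu])
  ultimately obtain \<phi> where \<phi>: "\<phi> \<in> hom C (total C P) (total C F)" "\<phi> \<cdot> f = f'"
    using coequalizer_factor[OF _ m'(3) n'(3)] by blast
  note [simp] = \<phi>(1)[unfolded hom_iff]
  have "splext_mor C P F c r \<phi>"
  proof (rule splext_morI[OF P F c _ \<phi>(1)])
    show "incl F \<cdot> c = \<phi> \<cdot> incl P"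
    proof (rule regular_epi_epi[OF a, where Z = "total C F"])
      show "(incl F \<cdot> c) \<cdot> a = (\<phi> \<cdot> incl P) \<cdot> a"
        using n'(4) by (simp add: m'(4) comp_reassoc[OF \<phi>(2)])
    qed (simp_all add: hom_iff)
    show "proj F \<cdot> \<phi> = r \<cdot> proj P"
    proof (rule coequalizer_epi[OF coeq, where Z = "base C F"])
      show "(proj F \<cdot> \<phi>) \<cdot> f = (r \<cdot> proj P) \<cdot> f"
        by (simp add: m'(5) \<phi>(2) n'(5))
    qed (simp_all add: hom_iff)
    show "\<phi> \<cdot> sect P = sect F \<cdot> r"
      using m'(6) n'(6) comp_reassoc[OF \<phi>(2), of "sect D"] by simp
  qed (simp add: hom_iff)
  then show thesis using that by blast
qed

text \<open>The last clause is the universal property for an arbitrary arrow \<open>x\<close> on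
  kernels, not only for the identity: it is applied with a quotient map in this place.\<close>

lemma splext_base_change:
  assumes E: "E \<in> SplExt C K" and r: "r \<in> hom C R (base C E)"
  obtains P f where "P \<in> SplExt C K" "base C P = R" "splext_mor C P E (Id C K) r f"
    "\<And>D X x s. D \<in> SplExt C X \<Longrightarrow> base C D = R \<Longrightarrow> splext_mor C D E x r s \<Longrightarrow>
      \<exists>\<alpha>. splext_mor C D P x (Id C R) \<alpha>"
proof -
  note e = SplExtD[OF E]
  note [simp] = e(1-3)[unfolded hom_iff] hom_obj[OF e(1)] hom_obj[OF e(3)]
    r[unfolded hom_iff] hom_obj[OF r]
  obtain a b where p: "pullback C (proj E) r a b" using ex_pullback[OF e(1) r] by blast
  define A where "A = Dom C a"
  have a: "a \<in> hom C A (total C E)" and b: "b \<in> hom C A R" and ab: "proj E \<cdot> a = r \<cdot> b"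
    using pullback_hom[OF p] by (auto simp: hom_iff A_def)
  note [simp] = a[unfolded hom_iff] b[unfolded hom_iff]
  have "proj E \<cdot> (sect E \<cdot> r) = r \<cdot> Id C R" by (simp add: comp_reassoc[OF e(4)])
  then obtain s where s: "s \<in> hom C R A" "a \<cdot> s = sect E \<cdot> r" "b \<cdot> s = Id C R"
    using pullback_factor[OF p a b comp_hom[OF r e(2)] id_hom] hom_obj(1)[OF r] by blast
  have "proj E \<cdot> incl E = r \<cdot> zero_arr C K R" by (simp add: e(5))
  then obtain k where k: "k \<in> hom C K A" "a \<cdot> k = incl E" "b \<cdot> k = zero_arr C K R"
    using pullback_factor[OF p a b e(3), of "zero_arr C K R"] by (auto simp: hom_iff)
  note [simp] = s(1)[unfolded hom_iff] k(1)[unfolded hom_iff]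
  have ker: "kernel C b k"
  proof (rule kernelI[OF b k(1,3)])
    fix Z z assume z: "z \<in> hom C Z A" "b \<cdot> z = zero_arr C Z R"
    note [simp] = z(1)[unfolded hom_iff] hom_obj[OF z(1)]
    have "proj E \<cdot> (a \<cdot> z) = zero_arr C Z (base C E)"
      by (simp add: comp_reassoc[OF ab] z(2))
    then obtain u where u: "u \<in> hom C Z K" "incl E \<cdot> u = a \<cdot> z"
      using kernel_factor[OF e(6,1,3) comp_hom[OF z(1) a]] by blast
    note [simp] = u(1)[unfolded hom_iff]
    have "k \<cdot> u = z"
      by (rule pullback_eqI[OF p a, where Z = Z])
        (simp_all add: hom_iff comp_reassoc[OF k(2)] comp_reassoc[OF k(3)] u(2) z(2))
    with u(1) show "\<exists>u\<in>hom C Z K. k \<cdot> u = z" by blast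
  next
    fix Z u v assume u: "u \<in> hom C Z K" and v: "v \<in> hom C Z K" and kuv: "k \<cdot> u = k \<cdot> v"
    have "incl E \<cdot> u = a \<cdot> (k \<cdot> u)" "incl E \<cdot> v = a \<cdot> (k \<cdot> v)"
      using u v by (simp_all add: hom_iff comp_reassoc[OF k(2)])
    then have "incl E \<cdot> u = incl E \<cdot> v" using kuv by simp
    then show "u = v" using monicD[OF kernel_monic[OF e(6)], of u v Z] u v by simp
  qed
  define P where "P = \<lparr>proj = b, sect = s, incl = k\<rparr>"
  note P = SplExtI[OF b s(1,3) k(1) ker, folded P_def]
  have [simp]: "proj P = b" "sect P = s" "incl P = k" by (simp_all add: P_def)
  have "splext_mor C P E (Id C K) r a"
    by (rule splext_morI[OF P(1) E]) (simp_all add: hom_iff P(2,3) s k ab)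
  moreover have "\<exists>\<alpha>. splext_mor C D P x (Id C R) \<alpha>"
    if D: "D \<in> SplExt C X" and DR: "base C D = R" and m: "splext_mor C D E x r f" for D X x f
  proof -
    note m = splext_morD[OF m D E] and d = SplExtD[OF D, unfolded DR]
    note [simp] = m(1,3)[unfolded hom_iff] d(1-3)[unfolded hom_iff] hom_obj[OF d(3)]
    obtain \<alpha> where \<alpha>: "\<alpha> \<in> hom C (total C D) A" "a \<cdot> \<alpha> = f" "b \<cdot> \<alpha> = proj D"
      using pullback_factor[OF p a b m(3) d(1) m(5)] by blast
    note [simp] = \<alpha>(1)[unfolded hom_iff]
    have "k \<cdot> x = \<alpha> \<cdot> incl D"
      by (rule pullback_eqI[OF p a, of _ X])
        (simp_all add: hom_iff comp_reassoc[OF k(2)] comp_reassoc[OF k(3)] comp_reassoc[OF \<alpha>(2)]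
          comp_reassoc[OF \<alpha>(3)] m(4) d(5))
    moreover have "\<alpha> \<cdot> sect D = s"
      by (rule pullback_eqI[OF p a, of _ R])
        (simp_all add: hom_iff s(2,3) comp_reassoc[OF \<alpha>(2)] comp_reassoc[OF \<alpha>(3)] m(6) d(4))
    ultimately have "splext_mor C D P x (Id C R) \<alpha>"
      by (intro splext_morI[OF D P(1)]) (simp_all add: hom_iff DR P(2,3) \<alpha>(3))
    then show ?thesis by blast
  qed
  ultimately show thesis using that[OF P(1,2)] by blast
qed

section \<open>Actions and semidirect products\<close>

lemma coproduct_inj:
  assumes "A \<in> Obj C" "B \<in> Obj C"
  shows "coproduct C A B (inj1 C A B) (inj2 C A B)"
proof -
  have "\<exists>p. case p of (i, j) \<Rightarrow> coproduct C A B i j" using ex_coproduct[OF assms] by auto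
  from someI_ex[OF this] show ?thesis unfolding inj1_def inj2_def by (simp only: case_prod_unfold)
qed

lemma coproduct_univ:
  assumes "A \<in> Obj C" "B \<in> Obj C"
  shows "inj1 C A B \<in> hom C A (sum_obj C A B)" "inj2 C A B \<in> hom C B (sum_obj C A B)"
    "f \<in> hom C A Z \<Longrightarrow> g \<in> hom C B Z \<Longrightarrow>
      \<exists>!u. u \<in> hom C (sum_obj C A B) Z \<and> u \<cdot> inj1 C A B = f \<and> u \<cdot> inj2 C A B = g"
proof -
  obtain S where i: "inj1 C A B \<in> hom C A S" "inj2 C A B \<in> hom C B S"
    and univ: "\<forall>Z. \<forall>x \<in> hom C A Z. \<forall>y \<in> hom C B Z.
           (\<exists>!u. u \<in> hom C S Z \<and> u \<cdot> inj1 C A B = x \<and> u \<cdot> inj2 C A B = y)"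
    using coproduct_inj[OF assms] unfolding coproduct_def by blast
  have S: "sum_obj C A B = S" using i by (simp add: sum_obj_def hom_iff)
  show "inj1 C A B \<in> hom C A (sum_obj C A B)" "inj2 C A B \<in> hom C B (sum_obj C A B)"
    using i S by auto
  show "f \<in> hom C A Z \<Longrightarrow> g \<in> hom C B Z \<Longrightarrow>
      \<exists>!u. u \<in> hom C (sum_obj C A B) Z \<and> u \<cdot> inj1 C A B = f \<and> u \<cdot> inj2 C A B = g"
    unfolding S using univ by blast
qed

lemma copair:
  assumes "f \<in> hom C A Z" "g \<in> hom C B Z"
  shows "copair C f g \<in> hom C (sum_obj C A B) Z"
    "copair C f g \<cdot> inj1 C A B = f" "copair C f g \<cdot> inj2 C A B = g"
proof -
  have [simp]: "Dom C f = A" "Dom C g = B" "Cod C f = Z" using assms by (auto simp: hom_iff)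
  have "copair C f g \<in> hom C (sum_obj C A B) Z \<and>
    copair C f g \<cdot> inj1 C A B = f \<and> copair C f g \<cdot> inj2 C A B = g"
    using theI'[OF coproduct_univ(3)[OF hom_obj(1)[OF assms(1)] hom_obj(1)[OF assms(2)] assms]]
    by (simp add: copair_def)
  then show "copair C f g \<in> hom C (sum_obj C A B) Z"
    "copair C f g \<cdot> inj1 C A B = f" "copair C f g \<cdot> inj2 C A B = g" by auto
qed

lemma coproduct_eqI:
  assumes "A \<in> Obj C" "B \<in> Obj C" "u \<in> hom C (sum_obj C A B) Z" "v \<in> hom C (sum_obj C A B) Z"
    "u \<cdot> inj1 C A B = v \<cdot> inj1 C A B" "u \<cdot> inj2 C A B = v \<cdot> inj2 C A B"
  shows "u = v"
proof -
  note i = coproduct_univ(1,2)[OF assms(1,2)]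
  from coproduct_univ(3)[OF assms(1,2) comp_hom[OF i(1) assms(4)] comp_hom[OF i(2) assms(4)]]
  show ?thesis using assms(3-) by metis
qed

lemma flat_incl:
  assumes "B \<in> Obj C" "X \<in> Obj C"
  shows "flat_incl C B X \<in> hom C (flat C B X) (sum_obj C B X)"
    "kernel C (copair C (Id C B) (zero_arr C X B)) (flat_incl C B X)"
proof -
  have c: "copair C (Id C B) (zero_arr C X B) \<in> hom C (sum_obj C B X) B"
    by (rule copair(1)) (use assms in \<open>auto simp: hom_iff\<close>)
  then have "\<exists>k. kernel C (copair C (Id C B) (zero_arr C X B)) k" using ex_kernel by metis
  then show k: "kernel C (copair C (Id C B) (zero_arr C X B)) (flat_incl C B X)"
    unfolding flat_incl_def by (rule someI_ex)
  show "flat_incl C B X \<in> hom C (flat C B X) (sum_obj C B X)"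
    using kernel_hom[OF k] c by (auto simp: hom_iff flat_def)
qed

text \<open>The free point over \<open>B\<close> on \<open>X\<close>, packaged as a split extension
  so that the results on morphisms of split extensions apply to it.\<close>

definition flat_ext :: "'a \<Rightarrow> 'a \<Rightarrow> 'b splext" where
  "flat_ext B X = \<lparr>proj = copair C (Id C B) (zero_arr C X B), sect = inj1 C B X,
     incl = flat_incl C B X\<rparr>"

lemma flat_ext:
  assumes "B \<in> Obj C" "X \<in> Obj C"
  shows "flat_ext B X \<in> SplExt C (flat C B X)" "base C (flat_ext B X) = B"
    "total C (flat_ext B X) = sum_obj C B X"
proof -
  have "Id C B \<in> hom C B B" "zero_arr C X B \<in> hom C X B" using assms by (auto simp: hom_iff)
  note c = copair[OF this]
  show "flat_ext B X \<in> SplExt C (flat C B X)" "base C (flat_ext B X) = B"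
    "total C (flat_ext B X) = sum_obj C B X"
    unfolding flat_ext_def
    using SplExtI[OF c(1) coproduct_univ(1)[OF assms] c(2) flat_incl[OF assms]] by auto
qed

lemma flat_unit:
  assumes "B \<in> Obj C" "X \<in> Obj C"
  shows "flat_unit C B X \<in> hom C X (flat C B X)"
proof -
  have "Id C B \<in> hom C B B" "zero_arr C X B \<in> hom C X B" using assms by (auto simp: hom_iff)
  note c = copair[OF this]
  note f = flat_incl[OF assms]
  obtain u where u: "u \<in> hom C X (flat C B X)" "flat_incl C B X \<cdot> u = inj2 C B X"
    using kernel_factor[OF f(2) c(1) f(1) coproduct_univ(2)[OF assms] c(3)] by blast
  have "\<exists>!u. u \<in> hom C X (flat C B X) \<and> flat_incl C B X \<cdot> u = inj2 C B X"
  proof (rule ex1I)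
    show "u \<in> hom C X (flat C B X) \<and> flat_incl C B X \<cdot> u = inj2 C B X" using u by blast
    fix v assume "v \<in> hom C X (flat C B X) \<and> flat_incl C B X \<cdot> v = inj2 C B X"
    then show "v = u"
      using monicD[OF kernel_monic[OF f(2)], of v u X] u f(1) by (simp add: hom_iff)
  qed
  from theI'[OF this] show ?thesis unfolding flat_unit_def by blast
qed

text \<open>By the unit law, \<open>flat_unit\<close> is a section of \<open>\<xi>\<close>.\<close>

lemma action_regular_epi:
  assumes "internal_action C B X \<xi>"
  shows "regular_epi C \<xi>"
  using assms split_epi_regular[OF _ flat_unit] unfolding internal_action_def by blast

lemma flat_map:
  assumes "B \<in> Obj C" "c \<in> hom C X Y"
  shows "flat_map C B c \<in> hom C (flat C B X) (flat C B Y)"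
    "flat_incl C B Y \<cdot> flat_map C B c = copair C (inj1 C B Y) (inj2 C B Y \<cdot> c) \<cdot> flat_incl C B X"
proof -
  note o = hom_obj[OF assms(2)]
  note k = flat_incl[OF assms(1) o(1)] and l = flat_incl[OF assms(1) o(2)]
  note i = coproduct_univ(1,2)[OF assms(1) o(2)] and j = coproduct_univ(1,2)[OF assms(1) o(1)]
  have z: "Id C B \<in> hom C B B" "zero_arr C X B \<in> hom C X B" "zero_arr C Y B \<in> hom C Y B"
    using assms o by (auto simp: hom_iff)
  note pX = copair[OF z(1,2)] and pY = copair[OF z(1,3)]
  note h = copair[OF i(1) comp_hom[OF assms(2) i(2)]]
  note [simp] = assms(2)[unfolded hom_iff] i[unfolded hom_iff] j[unfolded hom_iff]
    pX(1)[unfolded hom_iff] pY(1)[unfolded hom_iff] h(1)[unfolded hom_iff] k(1)[unfolded hom_iff]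
    l(1)[unfolded hom_iff] assms(1) o hom_obj(1)[OF k(1)]
  have "copair C (Id C B) (zero_arr C Y B) \<cdot> copair C (inj1 C B Y) (inj2 C B Y \<cdot> c) =
    copair C (Id C B) (zero_arr C X B)"
    by (rule coproduct_eqI[OF assms(1) o(1), where Z = B])
      (simp_all add: hom_iff pX pY h comp_reassoc[OF pY(3)])
  note * = comp_reassoc[OF this]
  have "copair C (Id C B) (zero_arr C Y B) \<cdot>
      (copair C (inj1 C B Y) (inj2 C B Y \<cdot> c) \<cdot> flat_incl C B X) = zero_arr C (flat C B X) B"
    using kernel_hom(3)[OF k(2)] by (simp add: *)
  then obtain u where u: "u \<in> hom C (flat C B X) (flat C B Y)"
    "flat_incl C B Y \<cdot> u = copair C (inj1 C B Y) (inj2 C B Y \<cdot> c) \<cdot> flat_incl C B X"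
    using kernel_factor[OF l(2) pY(1) l(1) comp_hom[OF k(1) h(1)]] by blast
  have "\<exists>!u. u \<in> hom C (flat C B X) (flat C B Y) \<and>
    flat_incl C B Y \<cdot> u = copair C (inj1 C B Y) (inj2 C B Y \<cdot> c) \<cdot> flat_incl C B X"
  proof (rule ex1I)
    show "u \<in> hom C (flat C B X) (flat C B Y) \<and>
      flat_incl C B Y \<cdot> u = copair C (inj1 C B Y) (inj2 C B Y \<cdot> c) \<cdot> flat_incl C B X"
      using u by blast
    fix v assume "v \<in> hom C (flat C B X) (flat C B Y) \<and>
      flat_incl C B Y \<cdot> v = copair C (inj1 C B Y) (inj2 C B Y \<cdot> c) \<cdot> flat_incl C B X"
    then show "v = u"
      using monicD[OF kernel_monic[OF l(2)], of v u "flat C B X"] u by simp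
  qed
  from theI'[OF this] show "flat_map C B c \<in> hom C (flat C B X) (flat C B Y)"
    "flat_incl C B Y \<cdot> flat_map C B c = copair C (inj1 C B Y) (inj2 C B Y \<cdot> c) \<cdot> flat_incl C B X"
    unfolding flat_map_def by simp_all
qed

text \<open>With \<open>c\<close> the identity this is the counit at \<open>E\<close>; a general
  \<open>c\<close> gives its analogue for an arrow from \<open>X\<close> into the kernel of another
  point. The equation \<open>eq\<close> identifies \<open>a\<close> as the kernel part.\<close>

lemma flat_ext_mor:
  assumes E: "E \<in> SplExt C Y" and c: "c \<in> hom C X Y" and a: "a \<in> hom C (flat C (base C E) X) Y"
    and eq: "incl E \<cdot> a = copair C (sect E) (incl E \<cdot> c) \<cdot> flat_incl C (base C E) X"
  shows "splext_mor C (flat_ext (base C E) X) E a (Id C (base C E)) (copair C (sect E) (incl E \<cdot> c))"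
proof -
  note e = SplExtD[OF E]
  note o = hom_obj(2)[OF e(1)] hom_obj(1)[OF c]
  note f = flat_ext[OF o]
  have g: "proj (flat_ext (base C E) X) = copair C (Id C (base C E)) (zero_arr C X (base C E))"
    "sect (flat_ext (base C E) X) = inj1 C (base C E) X"
    "incl (flat_ext (base C E) X) = flat_incl C (base C E) X"
    by (simp_all add: flat_ext_def)
  have z: "Id C (base C E) \<in> hom C (base C E) (base C E)"
    "zero_arr C X (base C E) \<in> hom C X (base C E)"
    using o by (auto simp: hom_iff)
  note p = copair[OF z]
  note h = copair[OF e(2) comp_hom[OF c e(3)]]
  note i = coproduct_univ(1,2)[OF o]
  note [simp] = e(1-3)[unfolded hom_iff] c[unfolded hom_iff] p(1)[unfolded hom_iff]
    h(1)[unfolded hom_iff] i[unfolded hom_iff] o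
  have "proj E \<cdot> copair C (sect E) (incl E \<cdot> c) = copair C (Id C (base C E)) (zero_arr C X (base C E))"
    by (rule coproduct_eqI[OF o, where Z = "base C E"])
      (simp_all add: hom_iff p h e(4) comp_reassoc[OF e(5)])
  then show ?thesis
    by (intro splext_morI[OF f(1) E a]) (simp_all add: hom_iff f(2,3) g eq h)
qed

text \<open>Both semidirect products receive a morphism from \<open>B\<flat>X \<rightarrow> B + X \<rightleftarrows> B\<close>, with kernel part \<open>\<xi>X\<close>
  for the first and \<open>c \<cdot> \<xi>X\<close> for the second.\<close>

lemma semidirect_map:
  assumes X: "internal_action C B X \<xi>X" "semidirect C B X \<xi>X E"
    and Y: "semidirect C B Y \<xi>Y F" and c: "c \<in> hom C X Y"
    and eq: "c \<cdot> \<xi>X = \<xi>Y \<cdot> flat_map C B c" and yh: "\<xi>Y \<in> hom C (flat C B Y) Y"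
  obtains \<phi> where "splext_mor C E F c (Id C B) \<phi>"
proof -
  have E: "E \<in> SplExt C X" and bE [simp]: "base C E = B"
    and iE: "incl E \<cdot> \<xi>X = copair C (sect E) (incl E) \<cdot> flat_incl C B X"
    using X(2) by (auto simp: semidirect_def)
  have F: "F \<in> SplExt C Y" and bF [simp]: "base C F = B"
    and iF: "incl F \<cdot> \<xi>Y = copair C (sect F) (incl F) \<cdot> flat_incl C B Y"
    using Y by (auto simp: semidirect_def)
  note e = SplExtD[OF E] and f = SplExtD[OF F]
  have B: "B \<in> Obj C" and Xo: "X \<in> Obj C" and xh: "\<xi>X \<in> hom C (flat C B X) X"
    using X(1) by (auto simp: internal_action_def)
  note Yo = hom_obj(2)[OF c]
  note fm = flat_map[OF B c] and fY = flat_incl[OF B Yo] and fX = flat_incl[OF B Xo]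
  note i = coproduct_univ(1,2)[OF B Yo] and j = coproduct_univ(1,2)[OF B Xo]
  have sF: "sect F \<in> hom C B (total C F)" using f(2) by simp
  note h = copair[OF sF comp_hom[OF c f(3)]]
  note g = copair[OF i(1) comp_hom[OF c i(2)]]
  note l = copair[OF sF f(3)]
  note [simp] = xh[unfolded hom_iff] yh[unfolded hom_iff] c[unfolded hom_iff] fm(1)[unfolded hom_iff]
    fX(1)[unfolded hom_iff] fY(1)[unfolded hom_iff] i[unfolded hom_iff] j[unfolded hom_iff]
    h(1)[unfolded hom_iff] g(1)[unfolded hom_iff] l(1)[unfolded hom_iff] f(3)[unfolded hom_iff]
    e(3)[unfolded hom_iff] B Xo Yo
  have *: "copair C (sect F) (incl F) \<cdot> copair C (inj1 C B Y) (inj2 C B Y \<cdot> c) =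
    copair C (sect F) (incl F \<cdot> c)"
    by (rule coproduct_eqI[OF B Xo, where Z = "total C F"])
      (simp_all add: hom_iff h g l comp_reassoc[OF l(3)])
  have "incl F \<cdot> (c \<cdot> \<xi>X) = copair C (sect F) (incl F) \<cdot> (flat_incl C B Y \<cdot> flat_map C B c)"
    unfolding eq by (simp add: comp_reassoc[OF iF])
  also have "\<dots> = copair C (sect F) (incl F \<cdot> c) \<cdot> flat_incl C B X"
    by (simp add: fm(2) comp_reassoc[OF *])
  finally have m2: "splext_mor C (flat_ext B X) F (c \<cdot> \<xi>X) (Id C B) (copair C (sect F) (incl F \<cdot> c))"
    using flat_ext_mor[OF F c, of "c \<cdot> \<xi>X"] by (simp add: hom_iff)
  have m1: "splext_mor C (flat_ext B X) E \<xi>X (Id C B) (copair C (sect E) (incl E))"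
    using flat_ext_mor[OF E id_hom[OF Xo], of \<xi>X] iE by (simp add: hom_iff)
  \<comment> \<open>As \<open>\<xi>X\<close> is a regular epimorphism, \<open>E\<close> is a
    quotient of the free point over the same base, and \<open>m2\<close>, whose kernel part factors
    through \<open>\<xi>X\<close>, descends to \<open>E\<close>.\<close>
  show thesis
    using splext_mor_factor[OF flat_ext(1)[OF B Xo] E F _ action_regular_epi[OF X(1)] m2 c]
      m1 flat_ext(2)[OF B Xo] that by metis
qed

section \<open>Canonical faithful split extensions\<close>

text \<open>The definition only supplies the arrows of \<open>T\<close>; that they form a split
  extension of \<open>X\<close> is derived here. The section law follows by cancelling the regular
  epimorphism \<open>e0\<close>, and the kernel property is inherited from \<open>F\<close> along
  the monic \<open>m1\<close>.\<close>

lemma canonical_faithfulE: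
  assumes "canonical_faithful C B X \<xi> T e0"
  obtains E F g f m0 e1 m1 where "semidirect C B X \<xi> E" "faithful C X F"
    "splext_mor C E F (Id C X) g f" "T \<in> SplExt C X" "splext_mor C E T (Id C X) e0 e1"
    "regular_epi C e0" "regular_epi C e1" "monic C m0" "monic C m1" "g = m0 \<cdot> e0" "f = m1 \<cdot> e1"
    "m0 \<in> hom C (base C T) (base C F)" "m1 \<in> hom C (total C T) (total C F)"
proof -
  obtain E F g f m0 e1 m1 where s: "semidirect C B X \<xi> E" and F: "faithful C X F"
    and m: "(g, f) \<in> SplExt_hom C X E F"
    and i0: "image_factorisation C g e0 m0" and i1: "image_factorisation C f e1 m1"
    and p: "proj T \<in> hom C (Cod C e1) (Cod C e0)" and pe: "proj T \<cdot> e1 = e0 \<cdot> proj E"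
    and mp: "m0 \<cdot> proj T = proj F \<cdot> m1"
    and t: "sect T \<in> hom C (Cod C e0) (Cod C e1)" and te: "sect T \<cdot> e0 = e1 \<cdot> sect E"
    and k: "incl T = e1 \<cdot> incl E"
    using assms unfolding canonical_faithful_def by blast
  have E: "E \<in> SplExt C X" using s by (simp add: semidirect_def)
  have FX: "F \<in> SplExt C X" using F by (simp add: faithful_def)
  have m: "splext_mor C E F (Id C X) g f" using m by (simp add: SplExt_hom_def)
  note mm = splext_morD[OF m E FX]
  have r0: "regular_epi C e0" and mo0: "monic C m0" and g: "g = m0 \<cdot> e0"
    and r1: "regular_epi C e1" and mo1: "monic C m1" and f: "f = m1 \<cdot> e1"
    and c: "Cod C e0 = Dom C m0" "Cod C e1 = Dom C m1"
    using i0 i1 by (auto simp: image_factorisation_def)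
  define I J where "I = Cod C e0" and "J = Cod C e1"
  have arr: "e0 \<in> Arr C" "e1 \<in> Arr C" "m0 \<in> Arr C" "m1 \<in> Arr C"
    using r0 r1 mo0 mo1 coequalizer_hom by (auto simp: regular_epi_def monic_def hom_iff)
  have e0: "e0 \<in> hom C (base C E) I" and m0: "m0 \<in> hom C I (base C F)"
    and e1: "e1 \<in> hom C (total C E) J" and m1: "m1 \<in> hom C J (total C F)"
    using mm(2,3) arr c unfolding g f I_def J_def by (auto simp: hom_iff)
  note p = p[folded I_def J_def] and t = t[folded I_def J_def]
  note e = SplExtD[OF E] and q = SplExtD[OF FX]
  note [simp] = e0[unfolded hom_iff] e1[unfolded hom_iff] m0[unfolded hom_iff] m1[unfolded hom_iff]
    p[unfolded hom_iff] t[unfolded hom_iff] e(1-3)[unfolded hom_iff] q(1-3)[unfolded hom_iff]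
    hom_obj[OF e0] hom_obj[OF e(3)] hom_obj[OF q(1)]
  have kT: "incl T \<in> hom C X J" by (simp add: k hom_iff)
  note [simp] = kT[unfolded hom_iff]
  have mk: "m1 \<cdot> incl T = incl F" using mm(4) by (simp add: k f)
  have pt: "proj T \<cdot> sect T = Id C I"
  proof (rule regular_epi_epi[OF r0, where Z = I])
    show "(proj T \<cdot> sect T) \<cdot> e0 = Id C I \<cdot> e0"
      by (simp add: te comp_reassoc[OF pe] e(4))
  qed (simp_all add: hom_iff)
  have ker: "kernel C (proj T) (incl T)"
  proof (rule kernelI[OF p kT])
    show "proj T \<cdot> incl T = zero_arr C X I"
      unfolding k by (simp add: comp_reassoc[OF pe] e(5))
  next
    fix Z z assume z: "z \<in> hom C Z J" "proj T \<cdot> z = zero_arr C Z I"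
    note [simp] = z(1)[unfolded hom_iff] hom_obj[OF z(1)]
    have "proj F \<cdot> (m1 \<cdot> z) = zero_arr C Z (base C F)"
      by (simp add: comp_reassoc[OF mp[symmetric]] z(2))
    then obtain u where u: "u \<in> hom C Z X" "incl F \<cdot> u = m1 \<cdot> z"
      using kernel_factor[OF q(6,1,3) comp_hom[OF z(1) m1]] by blast
    note [simp] = u(1)[unfolded hom_iff]
    have "m1 \<cdot> (incl T \<cdot> u) = m1 \<cdot> z" by (simp add: comp_reassoc[OF mk] u(2))
    then have "incl T \<cdot> u = z"
      using monicD[OF mo1, of "incl T \<cdot> u" z Z] by (simp add: hom_iff)
    with u(1) show "\<exists>u\<in>hom C Z X. incl T \<cdot> u = z" by blast
  next
    fix Z u v assume u: "u \<in> hom C Z X" and v: "v \<in> hom C Z X" and uv: "incl T \<cdot> u = incl T \<cdot> v"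
    have "incl F \<cdot> u = m1 \<cdot> (incl T \<cdot> u)" "incl F \<cdot> v = m1 \<cdot> (incl T \<cdot> v)"
      using u v by (simp_all add: hom_iff comp_reassoc[OF mk])
    then have "incl F \<cdot> u = incl F \<cdot> v" using uv by simp
    then show "u = v" using monicD[OF kernel_monic[OF q(6)], of u v Z] u v by simp
  qed
  have bT: "base C T = I" "total C T = J" by (simp_all add: base_def total_def)
  have T: "T \<in> SplExt C X"
    using p t pt ker by (simp add: SplExt_def point_def bT)
  have "splext_mor C E T (Id C X) e0 e1"
    by (rule splext_morI[OF E T]) (simp_all add: hom_iff bT pe te, simp add: k)
  then show thesis using that[OF s F m T _ r0 r1 mo0 mo1 g f] m0 m1 bT by blast
qed

text \<open>The kernel part of the morphism is an identity, whose kernel pair is trivial. Hence the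
  componentwise kernel pair still has kernel \<open>K\<close>, and both of its legs are morphisms of
  \<open>SplExt C K\<close>.\<close>

lemma kernel_pair_splext:
  assumes E: "E \<in> SplExt C K" and F: "F \<in> SplExt C K" and m: "splext_mor C E F (Id C K) g f"
  obtains D r1 r2 s1 s2 where "D \<in> SplExt C K" "pullback C g g r1 r2" "pullback C f f s1 s2"
    "splext_mor C D E (Id C K) r1 s1" "splext_mor C D E (Id C K) r2 s2"
proof -
  note mm = splext_morD[OF m E F]
  have K: "K \<in> Obj C" using hom_obj[OF mm(1)] by blast
  obtain r1 r2 where r: "pullback C g g r1 r2" using ex_pullback[OF mm(2,2)] by blast
  obtain s1 s2 where s: "pullback C f f s1 s2" using ex_pullback[OF mm(3,3)] by blast
  show thesis
    using splext_pullback[OF E E F m m pullback_Id_left[OF id_hom[OF K]] r s] that[OF _ r s] K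
    by auto
qed

text \<open>The two composites from \<open>P\<close> through \<open>E\<close> into the faithful
  \<open>F\<close> are parallel in \<open>SplExt C K\<close>, hence equal; the base component is
  what is needed later.\<close>

lemma faithful_eq:
  assumes F: "faithful C K F" and m: "splext_mor C E F (Id C K) g f" and K: "K \<in> Obj C"
    and P: "splext_mor C P E (Id C K) r s" "splext_mor C P E (Id C K) r' s'"
  shows "g \<cdot> r = g \<cdot> r'"
proof -
  have "splext_mor C P F (Id C K) (g \<cdot> r) (f \<cdot> s)" "splext_mor C P F (Id C K) (g \<cdot> r') (f \<cdot> s')"
    using splext_mor_comp[OF P(1) m] splext_mor_comp[OF P(2) m] K by simp_all
  moreover from this have "P \<in> SplExt C K" using K by (simp add: splext_mor_def)
  ultimately show ?thesis using F unfolding faithful_def SplExt_hom_def by blast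
qed

text \<open>Pulling \<open>D\<close> back along \<open>\<psi>\<close> over both of its legs gives one split extension with kernel \<open>H\<close>
  that maps to \<open>N\<close> over \<open>r1\<close> and over \<open>r2\<close>; monicity of \<open>h\<close> keeps the kernel equal to \<open>H\<close>.\<close>

lemma faithful_eq_sub:
  assumes h: "h \<in> hom C H G" "monic C h"
    and E: "E \<in> SplExt C G" and N: "N \<in> SplExt C H" and D: "D \<in> SplExt C G"
    and \<psi>: "splext_mor C N E h (Id C (base C E)) \<psi>"
    and d: "splext_mor C D E (Id C G) r1 s1" "splext_mor C D E (Id C G) r2 s2"
    and F: "faithful C H F" and m: "splext_mor C N F (Id C H) g f"
  shows "g \<cdot> r1 = g \<cdot> r2"
proof -
  note p = splext_morD[OF \<psi> N E] and d1 = splext_morD[OF d(1) D E] and d2 = splext_morD[OF d(2) D E]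
  have o [simp]: "H \<in> Obj C" "G \<in> Obj C" "base C D \<in> Obj C"
    using hom_obj[OF h(1)] hom_obj[OF d1(2)] by auto
  have hD: "Dom C h = H" using h(1) by (simp add: hom_iff)
  obtain e e' where pe: "pullback C s1 \<psi> e e'" using ex_pullback[OF d1(3) p(3)] by blast
  obtain W where W: "W \<in> SplExt C H" and WD: "splext_mor C W D h (Id C (base C D)) e"
    and WN: "splext_mor C W N (Id C H) r1 e'"
    using splext_pullback[OF D N E d(1) \<psi> pullback_Id_left[OF h(1)] pullback_Id_right[OF d1(2)] pe]
    unfolding hD by blast
  have WE: "splext_mor C W E h r2 (s2 \<cdot> e)"
    using splext_mor_comp[OF WD d(2)] h(1) d2(2) by (simp add: hom_iff)
  note w = splext_morD[OF WE W E]
  have [simp]: "base C W = base C D" using w(2) d2(2) by (simp add: hom_iff)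
  \<comment> \<open>Over \<open>r2\<close>, \<open>W\<close> is so far only mapped into
    \<open>E\<close>, not into \<open>N\<close>. This second pullback makes that map factor through
    \<open>\<psi>\<close> as well, and leaves the base unchanged.\<close>
  obtain c c' where pc: "pullback C (s2 \<cdot> e) \<psi> c c'" using ex_pullback[OF w(3) p(3)] by blast
  obtain V where V: "V \<in> SplExt C (Dom C (Id C H))"
    and VW: "splext_mor C V W (Id C H) (Id C (base C D)) c"
    and VN: "splext_mor C V N (Id C H) r2 c'"
    using splext_pullback[OF W N E WE \<psi> pullback_monic_Id[OF h(2,1)] pullback_Id_right[OF d2(2)] pc]
    by blast
  have "splext_mor C V N (Id C H) r1 (e' \<cdot> c)"
    using splext_mor_comp[OF VW WN] d1(2) by (simp add: hom_iff)
  from faithful_eq[OF F m _ this VN] show ?thesis by simp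
qed

text \<open>The quotient of \<open>D\<close> by the kernel of \<open>q\<close> is the base change of \<open>N\<close> along \<open>r1\<close>;
  the morphism from \<open>D\<close> to \<open>N\<close> over \<open>r2\<close> factors through it.\<close>

lemma faithful_eq_quot:
  assumes q: "q \<in> hom C G Q" "regular_epi C q"
    and E: "E \<in> SplExt C G" and N: "N \<in> SplExt C Q" and D: "D \<in> SplExt C G"
    and \<phi>: "splext_mor C E N q (Id C (base C E)) \<phi>"
    and d: "splext_mor C D E (Id C G) r1 s1" "splext_mor C D E (Id C G) r2 s2"
    and F: "faithful C Q F" and m: "splext_mor C N F (Id C Q) g f"
  shows "g \<cdot> r1 = g \<cdot> r2"
proof -
  note p = splext_morD[OF \<phi> E N] and d1 = splext_morD[OF d(1) D E] and d2 = splext_morD[OF d(2) D E]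
  have o [simp]: "Q \<in> Obj C" "G \<in> Obj C" using hom_obj[OF q(1)] by auto
  have [simp]: "base C N = base C E" using p(2) hom_obj[OF p(2)] by (simp add: hom_iff)
  note [simp] = d1(2)[unfolded hom_iff] d2(2)[unfolded hom_iff] q(1)[unfolded hom_iff]
  have n: "splext_mor C D N q r1 (\<phi> \<cdot> s1)" "splext_mor C D N q r2 (\<phi> \<cdot> s2)"
    using splext_mor_comp[OF d(1) \<phi>] splext_mor_comp[OF d(2) \<phi>] by simp_all
  have r1: "r1 \<in> hom C (base C D) (base C N)" using d1(2) by simp
  obtain P x \<alpha> where P: "P \<in> SplExt C Q" and PN: "splext_mor C P N (Id C Q) r1 x"
    and \<alpha>: "splext_mor C D P q (Id C (base C D)) \<alpha>"
    using splext_base_change[OF N r1] D n(1) by metis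
  \<comment> \<open>Writing \<open>q\<close> with an identity in front prescribes the identity as
    kernel part of the factored morphism, so that it lies in \<open>SplExt C Q\<close>.\<close>
  have "splext_mor C D N (Id C Q \<cdot> q) r2 (\<phi> \<cdot> s2)" using n(2) by simp
  then obtain x' where "splext_mor C P N (Id C Q) r2 x'"
    using splext_mor_factor[OF D P N \<alpha> q(2) _ id_hom] by auto
  from faithful_eq[OF F m _ PN this] show ?thesis by simp
qed

text \<open>Only bases are compared: \<open>h\<close> points from \<open>H\<close> to
  \<open>G\<close>, against the direction of the arrow \<open>t\<close>, so there is no arrow on
  kernels to go with it.\<close>

lemma canonical_faithful_sub:
  assumes h: "h \<in> hom C H G" "monic C h"
    and \<xi>: "internal_action C B G \<xi>" and \<xi>H: "internal_action C B H \<xi>H"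
    and eq: "h \<cdot> \<xi>H = \<xi> \<cdot> flat_map C B h"
    and TG: "canonical_faithful C B G \<xi> TG eG" and TH: "canonical_faithful C B H \<xi>H TH eH"
  shows "\<exists>t \<in> hom C (base C TG) (base C TH). t \<cdot> eG = eH"
proof -
  obtain E F g f m0 e1 m1 where sE: "semidirect C B G \<xi> E" and F: "faithful C G F"
    and EF: "splext_mor C E F (Id C G) g f" and T: "TG \<in> SplExt C G"
    and ET: "splext_mor C E TG (Id C G) eG e1" and eG: "regular_epi C eG" and g: "g = m0 \<cdot> eG"
    and m0: "m0 \<in> hom C (base C TG) (base C F)"
    using canonical_faithfulE[OF TG] by metis
  obtain N L k l n0 e1' n1 where sN: "semidirect C B H \<xi>H N" and L: "faithful C H L"
    and NL: "splext_mor C N L (Id C H) k l" and U: "TH \<in> SplExt C H"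
    and NU: "splext_mor C N TH (Id C H) eH e1'" and mono: "monic C n0" and k: "k = n0 \<cdot> eH"
    and n0: "n0 \<in> hom C (base C TH) (base C L)"
    using canonical_faithfulE[OF TH] by metis
  have E: "E \<in> SplExt C G" and N: "N \<in> SplExt C H" and FG: "F \<in> SplExt C G"
    and [simp]: "base C E = B" "base C N = B"
    using sE sN F by (auto simp: semidirect_def faithful_def)
  obtain \<psi> where \<psi>: "splext_mor C N E h (Id C (base C E)) \<psi>"
    using semidirect_map[OF \<xi>H sN sE h(1) eq] \<xi> by (auto simp: internal_action_def)
  obtain D r1 r2 s1 s2 where D: "D \<in> SplExt C G" and pr: "pullback C g g r1 r2"
    and d: "splext_mor C D E (Id C G) r1 s1" "splext_mor C D E (Id C G) r2 s2"
    using kernel_pair_splext[OF E FG EF] by metis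
  note r = splext_morD(2)[OF d(1) D E] splext_morD(2)[OF d(2) D E]
  note eG' = splext_morD(2)[OF ET E T] and eH = splext_morD(2)[OF NU N U]
  note [simp] = r[unfolded hom_iff] eH[unfolded hom_iff] n0[unfolded hom_iff]
  have "k \<cdot> r1 = k \<cdot> r2" by (rule faithful_eq_sub[OF h E N D \<psi> d L NL])
  \<comment> \<open>The equation was obtained in the base of the faithful extension
    \<open>L\<close>; the monic \<open>n0\<close> brings it back to the image.\<close>
  then have "eH \<cdot> r1 = eH \<cdot> r2"
    using monicD[OF mono, of "eH \<cdot> r1" "eH \<cdot> r2"] by (simp add: k hom_iff)
  moreover have "eH \<in> hom C (base C E) (base C TH)" using eH by simp
  ultimately show ?thesis using regular_epi_factor[OF eG eG' m0 pr[unfolded g]] by blast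
qed

text \<open>Here the kernel map \<open>q\<close> points the same way as the map on bases, so total
  objects are compared too, by factoring through \<open>e1\<close> as well as through
  \<open>eG\<close>.\<close>

lemma canonical_faithful_quot:
  assumes q: "q \<in> hom C G Q" "regular_epi C q"
    and \<xi>: "internal_action C B G \<xi>" and \<xi>Q: "internal_action C B Q \<xi>Q"
    and eq: "\<xi>Q \<cdot> flat_map C B q = q \<cdot> \<xi>"
    and TG: "canonical_faithful C B G \<xi> TG eG" and TQ: "canonical_faithful C B Q \<xi>Q TQ eQ"
  shows "\<exists>t0 t1. splext_mor C TG TQ q t0 t1"
proof -
  obtain E F g f m0 e1 m1 where sE: "semidirect C B G \<xi> E" and F: "faithful C G F"
    and EF: "splext_mor C E F (Id C G) g f" and T: "TG \<in> SplExt C G"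
    and ET: "splext_mor C E TG (Id C G) eG e1" and eG: "regular_epi C eG"
    and e1: "regular_epi C e1" and g: "g = m0 \<cdot> eG" and f: "f = m1 \<cdot> e1"
    and m0: "m0 \<in> hom C (base C TG) (base C F)" and m1: "m1 \<in> hom C (total C TG) (total C F)"
    using canonical_faithfulE[OF TG] by metis
  obtain N L k l n0 a1 n1 where sN: "semidirect C B Q \<xi>Q N" and L: "faithful C Q L"
    and NL: "splext_mor C N L (Id C Q) k l" and U: "TQ \<in> SplExt C Q"
    and NU: "splext_mor C N TQ (Id C Q) eQ a1" and mono: "monic C n0" and k: "k = n0 \<cdot> eQ"
    and n0: "n0 \<in> hom C (base C TQ) (base C L)"
    using canonical_faithfulE[OF TQ] by metis
  have E: "E \<in> SplExt C G" and N: "N \<in> SplExt C Q" and FG: "F \<in> SplExt C G"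
    and B [simp]: "base C E = B" "base C N = B"
    using sE sN F by (auto simp: semidirect_def faithful_def)
  obtain \<phi> where \<phi>: "splext_mor C E N q (Id C (base C E)) \<phi>"
    using semidirect_map[OF \<xi> sE sN q(1) eq[symmetric]] \<xi>Q by (auto simp: internal_action_def)
  obtain D r1 r2 s1 s2 where D: "D \<in> SplExt C G" and pr: "pullback C g g r1 r2"
    and ps: "pullback C f f s1 s2"
    and d: "splext_mor C D E (Id C G) r1 s1" "splext_mor C D E (Id C G) r2 s2"
    using kernel_pair_splext[OF E FG EF] by metis
  note r1 = splext_morD[OF d(1) D E] and r2 = splext_morD[OF d(2) D E]
  note eT = splext_morD[OF ET E T] and eU = splext_morD[OF NU N U] and p = splext_morD[OF \<phi> E N]
  have \<chi>: "splext_mor C E TQ q eQ (a1 \<cdot> \<phi>)"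
    using splext_mor_comp[OF \<phi> NU] q(1) eU(2) hom_obj[OF eU(2)] by (simp add: hom_iff)
  note x = splext_morD[OF \<chi> E U]
  define x1 where "x1 = a1 \<cdot> \<phi>"
  note x = x[folded x1_def]
  note dd = SplExtD[OF D] and ee = SplExtD[OF E] and t = SplExtD[OF T] and u = SplExtD[OF U]
  note [simp] = r1(2,3)[unfolded hom_iff] r2(2,3)[unfolded hom_iff] eT(2,3)[unfolded hom_iff]
    x(1-3)[unfolded hom_iff] n0[unfolded hom_iff] dd(1-3)[unfolded hom_iff] ee(1-3)[unfolded hom_iff]
    t(1-3)[unfolded hom_iff] u(1-3)[unfolded hom_iff]
    hom_obj[OF x(1)]
  have "k \<cdot> r1 = k \<cdot> r2" by (rule faithful_eq_quot[OF q E N D \<phi> d L NL])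
  then have er: "eQ \<cdot> r1 = eQ \<cdot> r2"
    using monicD[OF mono, of "eQ \<cdot> r1" "eQ \<cdot> r2"] by (simp add: k hom_iff)
  obtain t0 where t0: "t0 \<in> hom C (base C TG) (base C TQ)" "t0 \<cdot> eG = eQ"
    using regular_epi_factor[OF eG eT(2) m0 pr[unfolded g] x(2) er] by blast
  \<comment> \<open>On the kernel of \<open>D\<close> both legs restrict to \<open>incl E\<close>;
    on its section they differ by \<open>r1\<close> and \<open>r2\<close>, which \<open>eQ\<close>
    identifies.\<close>
  have "x1 \<cdot> s1 = x1 \<cdot> s2"
  proof (rule splext_jointly_epic[OF D, where P = "total C TQ"])
    show "(x1 \<cdot> s1) \<cdot> sect D = (x1 \<cdot> s2) \<cdot> sect D"
      by (simp add: r1(6) r2(6) comp_reassoc[OF x(6)] er)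
    show "(x1 \<cdot> s1) \<cdot> incl D = (x1 \<cdot> s2) \<cdot> incl D"
      by (simp add: r1(4)[symmetric] r2(4)[symmetric])
  qed (simp_all add: hom_iff)
  then obtain t1 where t1: "t1 \<in> hom C (total C TG) (total C TQ)" "t1 \<cdot> e1 = x1"
    using regular_epi_factor[OF e1 eT(3) m1 ps[unfolded f] x(3)] by blast
  note [simp] = t0(1)[unfolded hom_iff] t1(1)[unfolded hom_iff]
  \<comment> \<open>The squares for projections and sections hold after precomposition with the
    regular epimorphisms \<open>e1\<close> and \<open>eG\<close>. The kernel square is direct, as
    \<open>incl TG\<close> is \<open>e1 \<cdot> incl E\<close>.\<close>
  have "splext_mor C TG TQ q t0 t1"
  proof (rule splext_morI[OF T U q(1) t0(1) t1(1)])
    have "incl TG = e1 \<cdot> incl E" using eT(4) by simp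
    then show "incl TQ \<cdot> q = t1 \<cdot> incl TG" by (simp add: comp_reassoc[OF t1(2)] x(4))
    show "proj TQ \<cdot> t1 = t0 \<cdot> proj TG"
    proof (rule regular_epi_epi[OF e1, where Z = "base C TQ"])
      show "(proj TQ \<cdot> t1) \<cdot> e1 = (t0 \<cdot> proj TG) \<cdot> e1"
        by (simp add: t1(2) eT(5) comp_reassoc[OF t0(2)] x(5))
    qed (simp_all add: hom_iff)
    show "t1 \<cdot> sect TG = sect TQ \<cdot> t0"
    proof (rule regular_epi_epi[OF eG, where Z = "total C TQ"])
      show "(t1 \<cdot> sect TG) \<cdot> eG = (sect TQ \<cdot> t0) \<cdot> eG"
        by (simp add: t0(2) eT(6)[symmetric] comp_reassoc[OF t1(2)] x(6))
    qed (simp_all add: hom_iff)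
  qed
  then show ?thesis by blast
qed

end

text \<open>In (ii), compatibility with the quotients of \<open>B\<close> gives "induces" its exact
  meaning: it determines \<open>t\<close>, since \<open>eG\<close> is epic.\<close>

theorem proposition6p3:
  fixes C :: "('o, 'm) cat"
  assumes "action_accessible_category C"
    and "h \<in> hom C H G" and "characteristic C h"
    and "q \<in> hom C G Q" and "cokernel C h q"
    and "internal_action C B G \<xi>"
    and "internal_action C B H \<xi>H" and "h \<cdot>\<^bsub>C\<^esub> \<xi>H = \<xi> \<cdot>\<^bsub>C\<^esub> flat_map C B h"
    and "internal_action C B Q \<xi>Q" and "\<xi>Q \<cdot>\<^bsub>C\<^esub> flat_map C B q = q \<cdot>\<^bsub>C\<^esub> \<xi>"
    and "canonical_faithful C B G \<xi> TG eG"
  shows "(\<forall>TQ eQ. canonical_faithful C B Q \<xi>Q TQ eQ \<longrightarrow>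
            (\<exists>t0 t1. splext_mor C TG TQ q t0 t1)) \<and>
         (\<forall>TH eH. canonical_faithful C B H \<xi>H TH eH \<longrightarrow>
            (\<exists>t \<in> hom C (base C TG) (base C TH). t \<cdot>\<^bsub>C\<^esub> eG = eH))"
proof -
  interpret action_accessible_category C by fact
  have "monic C h" using assms(3) by (simp add: characteristic_def)
  then show ?thesis
    using canonical_faithful_quot[OF assms(4) cokernel_regular_epi[OF assms(5)] assms(6,9,10,11)]
      canonical_faithful_sub[OF assms(2) _ assms(6,7,8,11)] by blast
qed

end
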